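(* Let $(X_2,X_3)$ be a centered real Gaussian random vector with $\mathrm{Var}(X_2)>0$ and $\mathrm{Var}(X_3)>0$. If $(m_2,m_3)\in\mathcal{S}$, then $$\frac{\left|E[X_2^{2m_2+1}X_3^{2m_3+1}]\right|}{(2m_2+1)(2m_3+1)\,E[X_2^{2m_2}X_3^{2m_3}]}\ \le\ \begin{cases}|\mathrm{Cov}(X_2,X_3)|, & \text{if } |\mathrm{Corr}(X_2,X_3)|\le\sqrt{t_{m_2,m_3}},\\[4pt] H_{m_2,m_3}\big([\mathrm{Corr}(X_2,X_3)]^2\big)\cdot|\mathrm{Cov}(X_2,X_3)|, & \text{if } \sqrt{t_{m_2,m_3}}<|\mathrm{Corr}(X_2,X_3)|.\end{cases}$$ Moreover, equality holds if and only if $X_2$ and $X_3$ are independent.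
   Context: A centered Gaussian random vector means a jointly Gaussian real random vector with mean zero; the covariance matrix is allowed to be singular, but each component has positive variance. $\mathrm{Cov}$ and $\mathrm{Corr}$ denote covariance and correlation. With $m_2,m_3$ ranging over positive integers, define $$\mathcal{S}:=\{(1,m_3):m_3\ge5\}\cup\{(2,m_3):m_3\ge3\}\cup\{(m_2,m_3):m_3\ge m_2\ge3\},$$ $$r_{m_2,m_3}=(2m_2+1)(2m_3+1)+1,\qquad t_{m_2,m_3}=\frac{1}{r_{m_2,m_3}+\left(1+\frac1{2m_2}\right)\left(1+\frac1{2m_3}\right)},$$ and, writing $r=r_{m_2,m_3}$, for $\frac1{r^2}<z\le1$, $$H_{m_2,m_3}(z)=\frac{(m_2+m_3+1)(rz-1)+\sqrt{[(m_3-m_2)(rz-1)]^2+(2m_2+1)^3(2m_3+1)^3z}}{r^2z-1}.$$ *)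

theory Defs
  imports "HOL-Probability.Probability"
begin

text \<open>The one-dimensional Gaussian law with mean \<open>\<mu>\<close> and standard deviation \<open>\<sigma> \<ge> 0\<close>. Since
  \<^term>\<open>normal_density \<mu> 0\<close> is identically \<open>0\<close>, the degenerate case \<open>\<sigma> = 0\<close> is the point mass at \<open>\<mu>\<close>.\<close>

definition gaussian_law :: "real \<Rightarrow> real \<Rightarrow> real measure" where
  "gaussian_law \<mu> \<sigma> =
     (if \<sigma> = 0 then return borel \<mu> else density lborel (\<lambda>x. ennreal (normal_density \<mu> \<sigma> x)))"

text \<open>Joint Gaussianity: every linear functional of the vector has a (possibly degenerate)
  Gaussian law, so the covariance matrix may be singular.\<close>

definition gaussian_vector :: "'w measure \<Rightarrow> ('w \<Rightarrow> 'b::euclidean_space) \<Rightarrow> bool" where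
  "gaussian_vector M X \<longleftrightarrow>
     X \<in> borel_measurable M \<and>
     (\<forall>u. \<exists>\<mu> \<sigma>. 0 \<le> \<sigma> \<and> distr M borel (\<lambda>\<omega>. X \<omega> \<bullet> u) = gaussian_law \<mu> \<sigma>)"

definition centered_gaussian_vector :: "'w measure \<Rightarrow> ('w \<Rightarrow> 'b::euclidean_space) \<Rightarrow> bool" where
  "centered_gaussian_vector M X \<longleftrightarrow> gaussian_vector M X \<and> (\<integral>\<omega>. X \<omega> \<partial>M) = 0"

definition Cov :: "'w measure \<Rightarrow> ('w \<Rightarrow> real) \<Rightarrow> ('w \<Rightarrow> real) \<Rightarrow> real" where
  "Cov M X Y = (\<integral>\<omega>. (X \<omega> - (\<integral>\<omega>'. X \<omega>' \<partial>M)) * (Y \<omega> - (\<integral>\<omega>'. Y \<omega>' \<partial>M)) \<partial>M)"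

definition Var :: "'w measure \<Rightarrow> ('w \<Rightarrow> real) \<Rightarrow> real" where
  "Var M X = (\<integral>\<omega>. (X \<omega> - (\<integral>\<omega>'. X \<omega>' \<partial>M))\<^sup>2 \<partial>M)"

definition Corr :: "'w measure \<Rightarrow> ('w \<Rightarrow> real) \<Rightarrow> ('w \<Rightarrow> real) \<Rightarrow> real" where
  "Corr M X Y = Cov M X Y / sqrt (Var M X * Var M Y)"

definition S_set :: "(nat \<times> nat) set" where
  "S_set = {(1, m3) | m3. m3 \<ge> 5} \<union> {(2, m3) | m3. m3 \<ge> 3} \<union> {(m2, m3). m3 \<ge> m2 \<and> m2 \<ge> 3}"

definition r_const :: "nat \<Rightarrow> nat \<Rightarrow> real" where
  "r_const m2 m3 = (2 * real m2 + 1) * (2 * real m3 + 1) + 1"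

definition t_const :: "nat \<Rightarrow> nat \<Rightarrow> real" where
  "t_const m2 m3 =
     1 / (r_const m2 m3 + (1 + 1 / (2 * real m2)) * (1 + 1 / (2 * real m3)))"

text \<open>Only meaningful for \<open>1 / r\<^sup>2 < z \<le> 1\<close> with \<open>r = r_const m2 m3\<close>. As
  \<open>t_const m2 m3 > 1 / r\<^sup>2\<close> for positive \<open>m2\<close>, \<open>m3\<close>, this covers \<open>t_const m2 m3 < z \<le> 1\<close>.\<close>

definition H_fun :: "nat \<Rightarrow> nat \<Rightarrow> real \<Rightarrow> real" where
  "H_fun m2 m3 z =
     (let r = r_const m2 m3 in
       ((real m2 + real m3 + 1) * (r * z - 1) +
        sqrt (((real m3 - real m2) * (r * z - 1))\<^sup>2 +
              (2 * real m2 + 1) ^ 3 * (2 * real m3 + 1) ^ 3 * z)) / (r\<^sup>2 * z - 1))"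

end

theory Submission
  imports Defs "HOL-Computational_Algebra.Polynomial"
begin

text \<open>
  Write \<open>a = 2 m\<^sub>2 + 1\<close>, \<open>b = 2 m\<^sub>3 + 1\<close>, \<open>s = a b\<close>, \<open>c = a + b\<close>, \<open>r = s + 1\<close> and \<open>x = Corr\<^sup>2\<close>.
  Comparing coefficients in the moments of \<open>X\<^sub>2 + \<tau> X\<^sub>3\<close> shows that the left-hand side is
  \<open>B(x) / A(x) * |Cov|\<close>, where \<open>A\<close> and \<open>B\<close> are the hypergeometric polynomials
  \<open>\<^sub>2F\<^sub>1(-m\<^sub>2, -m\<^sub>3; 1/2; x)\<close> and \<open>\<^sub>2F\<^sub>1(-m\<^sub>2, -m\<^sub>3; 3/2; x)\<close>. Hence \<open>B < A\<close> for \<open>x > 0\<close>, while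
  \<open>B/A < H\<close> amounts to positivity on \<open>[0, 1]\<close> of
  \<open>\<Psi> = s (1 - x) A\<^sup>2 + c (r x - 1) A B - (r\<^sup>2 x - 1) B\<^sup>2\<close>, because \<open>H\<close> is the larger root of the
  associated quadratic. The differential equations of \<open>A\<close> and \<open>B\<close> express each coefficient of \<open>\<Psi>\<close>
  through \<open>\<Sum>\<^sub>i B\<^sub>i B\<^sub>k\<^sub>-\<^sub>i\<close> and \<open>\<Sum>\<^sub>i B\<^sub>i B\<^sub>k\<^sub>-\<^sub>i (2 i - k)\<^sup>2\<close>; only the linear and the leading coefficient are
  negative. The leading one is dominated by its predecessor, and the quadratic part of \<open>\<Psi>\<close> has negative
  discriminant for \<open>(m\<^sub>2, m\<^sub>3)\<close> in \<open>S\<close> with \<open>m\<^sub>2 \<ge> 2\<close>; for \<open>m\<^sub>2 = 1\<close> the cubic \<open>\<Psi>\<close> is treated directly.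
\<close>

section \<open>The moment polynomials\<close>

text \<open>Since \<open>(1/2)_i = (2 i)! / (4^i i!)\<close>, this is the \<open>i\<close>-th
  coefficient of the series \<open>2F1(-m, -n; 1/2; x)\<close>. The binomials make it vanish beyond
  \<open>min m n\<close>.\<close>

definition even_coeff :: "nat \<Rightarrow> nat \<Rightarrow> nat \<Rightarrow> real" where
  "even_coeff m n i = real (m choose i) * real (n choose i) * (fact i)\<^sup>2 * 4 ^ i / fact (2 * i)"

definition even_poly :: "nat \<Rightarrow> nat \<Rightarrow> real poly" where
  "even_poly m n = (\<Sum>i\<le>m. monom (even_coeff m n i) i)"

definition odd_poly :: "nat \<Rightarrow> nat \<Rightarrow> real poly" where
  "odd_poly m n = (\<Sum>i\<le>m. monom (even_coeff m n i / (2 * real i + 1)) i)"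

lemma even_coeff_eq_0: "m < i \<Longrightarrow> even_coeff m n i = 0"
  by (simp add: even_coeff_def)

lemma even_coeff_0 [simp]: "even_coeff m n 0 = 1"
  by (simp add: even_coeff_def)

lemma even_coeff_nonneg: "even_coeff m n i \<ge> 0"
  by (simp add: even_coeff_def)

lemma even_coeff_pos: "i \<le> m \<Longrightarrow> i \<le> n \<Longrightarrow> even_coeff m n i > 0"
  by (simp add: even_coeff_def)

text \<open>The subtraction is taken in the reals, so the rule holds for every \<open>i\<close>: for
  \<open>i > m\<close> both sides vanish.\<close>

lemma choose_Suc_real: "real (m choose Suc i) * (real i + 1) = real (m choose i) * (real m - real i)"
proof (cases "i \<le> m")
  case True
  have "real (Suc i * (m choose Suc i)) = real ((m choose i) * (m - i))"
    by (metis binomial_absorption binomial_absorb_comp mult.commute)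
  with True show ?thesis by (simp add: of_nat_diff algebra_simps)
next
  case False
  then show ?thesis by (simp add: binomial_eq_0)
qed

text \<open>The hypergeometric term ratio with denominators cleared. It yields the differential
  equation of \<open>even_poly\<close> and the ratio rule for the \<beta>'s.\<close>

lemma even_coeff_Suc:
  "2 * (real i + 1) * (2 * real i + 1) * even_coeff m n (Suc i)
     = 4 * (real m - real i) * (real n - real i) * even_coeff m n i"
proof -
  have fact: "fact (2 * Suc i) = (2 * (real i + 1) * (2 * real i + 1)) * (fact (2 * i) :: real)"
    by (simp add: algebra_simps)
  have cancel: "d * (p * q * (x * f)\<^sup>2 * (4 * z) / (d * F)) = 4 * (p * x) * (q * x) * (f\<^sup>2 * z / F)"
    if "d \<noteq> 0" for d p q x f z F :: real
    using that by (simp add: power2_eq_square)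
  have "2 * (real i + 1) * (2 * real i + 1) * even_coeff m n (Suc i) =
      4 * (real (m choose Suc i) * (real i + 1)) * (real (n choose Suc i) * (real i + 1)) *
       ((fact i)\<^sup>2 * 4 ^ i / fact (2 * i))"
    unfolding even_coeff_def fact fact_Suc power_Suc of_nat_Suc add.commute[of 1 "real i"]
    by (rule cancel) (use of_nat_0_le_iff[of i, where ?'a = real] in simp)
  also have "\<dots> = 4 * (real m - real i) * (real n - real i) * even_coeff m n i"
    unfolding choose_Suc_real by (simp add: even_coeff_def)
  finally show ?thesis .
qed

lemma coeff_even_poly: "coeff (even_poly m n) i = even_coeff m n i"
proof -
  have "coeff (even_poly m n) i = (\<Sum>j\<le>m. if j = i then even_coeff m n j else 0)"
    by (simp add: even_poly_def coeff_sum)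
  also have "\<dots> = even_coeff m n i" by (simp add: even_coeff_eq_0)
  finally show ?thesis .
qed

lemma coeff_odd_poly: "coeff (odd_poly m n) i = even_coeff m n i / (2 * real i + 1)"
proof -
  have "coeff (odd_poly m n) i = (\<Sum>j\<le>m. if j = i then even_coeff m n j / (2 * real j + 1) else 0)"
    by (simp add: odd_poly_def coeff_sum)
  also have "\<dots> = even_coeff m n i / (2 * real i + 1)" by (simp add: even_coeff_eq_0)
  finally show ?thesis .
qed

text \<open>The operator \<open>1 + 2 x d/dx\<close> multiplies the \<open>i\<close>-th coefficient
  by \<open>2 i + 1\<close>, which undoes the division in \<open>odd_poly\<close>.\<close>

lemma odd_poly_pderiv: "[:0, 2:] * pderiv (odd_poly m n) = even_poly m n - odd_poly m n"
proof (rule poly_eqI)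
  fix k
  show "coeff ([:0, 2:] * pderiv (odd_poly m n)) k = coeff (even_poly m n - odd_poly m n) k"
    by (cases k) (simp_all add: coeff_pderiv coeff_even_poly coeff_odd_poly field_simps)
qed

text \<open>Completes a closed first-order system for the two polynomials. After multiplication by
  \<open>2 k + 1\<close> and use of the term ratio it comes down to \<open>4 (m - k) (n - k) - 2 k
  (2 k + 1) = (2 m + 1) (2 n + 1) - (2 k + 1) (2 m + 2 n + 1)\<close>.\<close>

lemma even_poly_pderiv:
  "smult 2 ([:1, -1:] * pderiv (even_poly m n)) =
     smult ((2 * real m + 1) * (2 * real n + 1)) (odd_poly m n) -
     smult (2 * real m + 2 * real n + 1) (even_poly m n)" (is "?l = ?r")
proof (rule poly_eqI)
  fix k
  have "(2 * real k + 1) * coeff ?l k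
      = 2 * (real k + 1) * (2 * real k + 1) * even_coeff m n (Suc k)
        - 2 * (2 * real k + 1) * real k * even_coeff m n k"
    by (cases k) (simp_all add: coeff_pderiv coeff_even_poly algebra_simps)
  also have "\<dots> = (2 * real k + 1) * coeff ?r k"
    unfolding even_coeff_Suc
    by (simp add: coeff_even_poly coeff_odd_poly right_diff_distrib) (simp add: algebra_simps)
  finally show "coeff ?l k = coeff ?r k"
    by (metis mult_cancel_left of_nat_0_le_iff add_pos_nonneg add.commute less_irrefl
        zero_less_one mult_nonneg_nonneg zero_le_numeral)
qed

text \<open>The weight \<open>l\<close> stays attached to \<open>pderiv p\<close>, so the
  first-order equations can be substituted without dividing by \<open>x\<close> or
  \<open>1 - x\<close>.\<close>

lemma pderiv_square_weighted:
  fixes p l :: "real poly"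
  shows "l * pderiv (p * p) = p * smult 2 (l * pderiv p)"
proof -
  have "smult 2 (l * pderiv p) = l * pderiv p + l * pderiv p"
    using smult_add_left[of 1 1 "l * pderiv p"] by simp
  then show ?thesis by (simp add: pderiv_mult algebra_simps)
qed

lemma pderiv_mult_weighted:
  fixes p q k l :: "real poly"
  shows "smult 2 k * (l * pderiv (p * q)) =
    k * (q * smult 2 (l * pderiv p)) + l * (p * (smult 2 k * pderiv q))"
  by (simp add: pderiv_mult smult_add_right algebra_simps)

section \<open>Recurrences for the coefficients of \<open>A * A\<close>, \<open>A * B\<close> and
  \<open>B * B\<close>\<close>

locale moment_pair =
  fixes m n :: nat
begin

definition a :: real where "a = 2 * real m + 1"
definition b :: real where "b = 2 * real n + 1"
definition s :: real where "s = a * b"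
definition c :: real where "c = a + b"

abbreviation A :: "real poly" where "A \<equiv> even_poly m n"
abbreviation B :: "real poly" where "B \<equiv> odd_poly m n"

definition u :: "nat \<Rightarrow> real" where "u k = coeff (A * A) k"
definition v :: "nat \<Rightarrow> real" where "v k = coeff (A * B) k"
definition w :: "nat \<Rightarrow> real" where "w k = coeff (B * B) k"

lemma A_pderiv: "smult 2 ([:1, -1:] * pderiv A) = smult s B - smult (c - 1) A"
  unfolding even_poly_pderiv s_def c_def a_def b_def by (simp add: algebra_simps)

lemma u_rec: "(real k + 1) * u (Suc k) = s * v k - (c - 1 - real k) * u k"
proof -
  have "[:1, -1:] * pderiv (A * A) = A * smult 2 ([:1, -1:] * pderiv A)"
    by (rule pderiv_square_weighted)
  also have "\<dots> = smult s (A * B) - smult (c - 1) (A * A)"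
    unfolding A_pderiv by (simp add: right_diff_distrib)
  finally have "coeff ([:1, -1:] * pderiv (A * A)) k = s * v k - (c - 1) * u k"
    by (simp add: u_def v_def)
  moreover have "coeff ([:1, -1:] * pderiv (A * A)) k = (real k + 1) * u (Suc k) - real k * u k"
    by (cases k) (simp_all add: coeff_pderiv u_def)
  ultimately show ?thesis by (simp add: algebra_simps)
qed

text \<open>The differential equation of \<open>B\<close> amounts to
  \<open>A B = (x B^2)'\<close>.\<close>

lemma v_w: "v k = (real k + 1) * w k"
proof -
  have "[:0, 1:] * pderiv (B * B) = B * ([:0, 2:] * pderiv B)"
    using pderiv_square_weighted[of "[:0, 1:]" B] by simp
  also have "\<dots> = A * B - B * B" unfolding odd_poly_pderiv by (simp add: algebra_simps)
  finally have "coeff ([:0, 1:] * pderiv (B * B)) k = v k - w k"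
    by (simp add: v_def w_def)
  moreover have "coeff ([:0, 1:] * pderiv (B * B)) k = real k * w k"
    by (cases k) (simp_all add: coeff_pderiv w_def)
  ultimately show ?thesis by (simp add: algebra_simps)
qed

text \<open>Both differential equations enter, with common weight \<open>2 x (1 - x)\<close>.
  Together with \<open>u_rec\<close> and \<open>v_w\<close> this determines index
  \<open>k + 1\<close> from index \<open>k\<close>.\<close>

lemma v_rec:
  "2 * (real k + 1) * v (Suc k) - 2 * real k * v k
     = s * w k - (c - 1) * v k + u (Suc k) - u k - v (Suc k) + v k"
proof -
  have "[:0, 2:] * ([:1, -1:] * pderiv (A * B)) =
      [:0, 1:] * (B * smult 2 ([:1, -1:] * pderiv A)) + [:1, -1:] * (A * ([:0, 2:] * pderiv B))"
    using pderiv_mult_weighted[of "[:0, 1:]" "[:1, -1:]" A B]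
    by (simp only: smult_pCons smult_0_right mult_zero_right mult_1_right)
  also have "\<dots> = [:0, 1:] * (smult s (B * B) - smult (c - 1) (A * B)) + [:1, -1:] * (A * A - A * B)"
    unfolding A_pderiv odd_poly_pderiv
    by (simp only: right_diff_distrib mult_smult_right mult.commute[of B A])
  finally have "coeff ([:0, 2:] * ([:1, -1:] * pderiv (A * B))) (Suc k) =
      coeff ([:0, 1:] * (smult s (B * B) - smult (c - 1) (A * B)) + [:1, -1:] * (A * A - A * B)) (Suc k)"
    by simp
  also have "\<dots> = s * w k - (c - 1) * v k + u (Suc k) - u k - v (Suc k) + v k"
    by (simp add: u_def v_def w_def)
  also have "coeff ([:0, 2:] * ([:1, -1:] * pderiv (A * B))) (Suc k)
      = 2 * (real k + 1) * v (Suc k) - 2 * real k * v k"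
    by (cases k) (simp_all add: coeff_pderiv v_def algebra_simps)
  finally show ?thesis .
qed

end

section \<open>Positivity of \<open>\<Psi>\<close>\<close>

text \<open>The two weights in the formula \<open>coeff_\<Psi>\<close> below. In the following estimates the parameters are
  shifted so that every monomial of the difference of the two sides has a nonnegative coefficient.\<close>

definition spread_factor :: "real \<Rightarrow> real \<Rightarrow> real \<Rightarrow> real" where
  "spread_factor s c k = (2 * k + 1) * (k + 1) * s - c * (k + 1) + 1"

definition mass_factor :: "real \<Rightarrow> real \<Rightarrow> real \<Rightarrow> real" where
  "mass_factor s c k =
     (2 * k + 1) * (k + 1) * (2 * s + 1 - c * k) + 2 * (c * (k + 1) - 1) * (s - c * k + k\<^sup>2)"

text \<open>For even \<open>k\<close> the preceding index is odd, where \<open>w\<close> is at most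
  \<open>spread\<close>, so comparing the weights is enough. The shifts encode
  \<open>k \<le> 2 m\<close> and \<open>m \<le> n\<close>.\<close>

lemma mass_factor_le_even:
  fixes i j l :: real
  assumes "i \<ge> 0" "j \<ge> 0" "l \<ge> 0"
  defines "k \<equiv> 2 * l + 2" and "m \<equiv> l + 1 + i" and "n \<equiv> l + 1 + i + j"
  defines "s \<equiv> (2 * m + 1) * (2 * n + 1)" and "c \<equiv> 2 * m + 2 * n + 2"
  shows "k * mass_factor s c k \<le> c * spread_factor s c k"
proof -
  have "c * spread_factor s c k - k * mass_factor s c k =
     430 + 680 * i + 328 * i * j + 704 * i * j * l + 512 * i * j * l ^ 2 + 128 * i * j * l ^ 3
      + 24 * i * j ^ 2 + 16 * i * j ^ 2 * l + 2184 * i * l + 2592 * i * l ^ 2 + 1344 * i * l ^ 3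
      + 256 * i * l ^ 4 + 328 * i ^ 2 + 72 * i ^ 2 * j + 48 * i ^ 2 * j * l + 704 * i ^ 2 * l
      + 512 * i ^ 2 * l ^ 2 + 128 * i ^ 2 * l ^ 3 + 48 * i ^ 3 + 32 * i ^ 3 * l + 340 * j
      + 1092 * j * l + 1296 * j * l ^ 2 + 672 * j * l ^ 3 + 128 * j * l ^ 4 + 120 * j ^ 2
      + 296 * j ^ 2 * l + 240 * j ^ 2 * l ^ 2 + 64 * j ^ 2 * l ^ 3 + 1794 * l + 2900 * l ^ 2
      + 2272 * l ^ 3 + 864 * l ^ 4 + 128 * l ^ 5"
    unfolding spread_factor_def mass_factor_def s_def c_def k_def m_def n_def by algebra
  also have "\<dots> \<ge> 0"
    by (intro add_nonneg_nonneg mult_nonneg_nonneg zero_le_power zero_le_numeral assms(1-3))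
  finally show ?thesis by simp
qed

text \<open>For odd \<open>k\<close> the central product in \<open>w (k - 1)\<close> contributes
  nothing to \<open>spread\<close>, which costs the factor \<open>8 q / (q' + 2 q)\<close>. Here
  \<open>q / q'\<close> is the ratio of \<open>\<beta> l * \<beta> (l + 2)\<close> to the central
  square.\<close>

lemma mass_factor_le_odd:
  fixes i j l :: real
  assumes "i \<ge> 0" "j \<ge> 0" "l \<ge> 0"
  defines "k \<equiv> 2 * l + 3" and "m \<equiv> l + 2 + i" and "n \<equiv> l + 2 + i + j"
  defines "s \<equiv> (2 * m + 1) * (2 * n + 1)" and "c \<equiv> 2 * m + 2 * n + 2"
  defines "q \<equiv> (1 + i) * (1 + i + j) * (l + 1) * (2 * l + 3)"
    and "q' \<equiv> (2 + i) * (2 + i + j) * (l + 2) * (2 * l + 5)"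
  shows "(q' + 2 * q) * (k * mass_factor s c k) \<le> 8 * q * (c * spread_factor s c k)"
proof -
  have "8 * q * (c * spread_factor s c k) - (q' + 2 * q) * (k * mass_factor s c k) =
     34440 + 158928 * i + 233664 * i * j + 1179580 * i * j * l + 2136474 * i * j * l ^ 2
      + 1929832 * i * j * l ^ 3 + 961912 * i * j * l ^ 4 + 266208 * i * j * l ^ 5
      + 37632 * i * j * l ^ 6 + 2048 * i * j * l ^ 7 + 90144 * i * j ^ 2
      + 384336 * i * j ^ 2 * l + 597196 * i * j ^ 2 * l ^ 2 + 452600 * i * j ^ 2 * l ^ 3
      + 179376 * i * j ^ 2 * l ^ 4 + 35360 * i * j ^ 2 * l ^ 5 + 2688 * i * j ^ 2 * l ^ 6
      + 10368 * i * j ^ 3 + 37632 * i * j ^ 3 * l + 49760 * i * j ^ 3 * l ^ 2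
      + 30848 * i * j ^ 3 * l ^ 3 + 9088 * i * j ^ 3 * l ^ 4 + 1024 * i * j ^ 3 * l ^ 5
      + 949576 * i * l + 1930032 * i * l ^ 2 + 1944032 * i * l ^ 3 + 1091584 * i * l ^ 4
      + 348032 * i * l ^ 5 + 58880 * i * l ^ 6 + 4096 * i * l ^ 7 + 233664 * i ^ 2
      + 222048 * i ^ 2 * j + 972144 * i ^ 2 * j * l + 1542756 * i ^ 2 * j * l ^ 2
      + 1195752 * i ^ 2 * j * l ^ 3 + 487440 * i ^ 2 * j * l ^ 4 + 99936 * i ^ 2 * j * l ^ 5
      + 8064 * i ^ 2 * j * l ^ 6 + 52992 * i ^ 2 * j ^ 2 + 199464 * i ^ 2 * j ^ 2 * l
      + 268688 * i ^ 2 * j ^ 2 * l ^ 2 + 168288 * i ^ 2 * j ^ 2 * l ^ 3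
      + 49856 * i ^ 2 * j ^ 2 * l ^ 4 + 5632 * i ^ 2 * j ^ 2 * l ^ 5 + 2304 * i ^ 2 * j ^ 3
      + 7488 * i ^ 2 * j ^ 3 * l + 8288 * i ^ 2 * j ^ 3 * l ^ 2 + 3840 * i ^ 2 * j ^ 3 * l ^ 3
      + 640 * i ^ 2 * j ^ 3 * l ^ 4 + 1179580 * i ^ 2 * l + 2136474 * i ^ 2 * l ^ 2
      + 1929832 * i ^ 2 * l ^ 3 + 961912 * i ^ 2 * l ^ 4 + 266208 * i ^ 2 * l ^ 5
      + 37632 * i ^ 2 * l ^ 6 + 2048 * i ^ 2 * l ^ 7 + 148032 * i ^ 3 + 85248 * i ^ 3 * j
      + 323664 * i ^ 3 * j * l + 437856 * i ^ 3 * j * l ^ 2 + 274880 * i ^ 3 * j * l ^ 3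
      + 81536 * i ^ 3 * j * l ^ 4 + 9216 * i ^ 3 * j * l ^ 5 + 9216 * i ^ 3 * j ^ 2
      + 29952 * i ^ 3 * j ^ 2 * l + 33152 * i ^ 3 * j ^ 2 * l ^ 2
      + 15360 * i ^ 3 * j ^ 2 * l ^ 3 + 2560 * i ^ 3 * j ^ 2 * l ^ 4 + 648096 * i ^ 3 * l
      + 1028504 * i ^ 3 * l ^ 2 + 797168 * i ^ 3 * l ^ 3 + 324960 * i ^ 3 * l ^ 4
      + 66624 * i ^ 3 * l ^ 5 + 5376 * i ^ 3 * l ^ 6 + 42624 * i ^ 4 + 11520 * i ^ 4 * j
      + 37440 * i ^ 4 * j * l + 41440 * i ^ 4 * j * l ^ 2 + 19200 * i ^ 4 * j * l ^ 3
      + 3200 * i ^ 4 * j * l ^ 4 + 161832 * i ^ 4 * l + 218928 * i ^ 4 * l ^ 2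
      + 137440 * i ^ 4 * l ^ 3 + 40768 * i ^ 4 * l ^ 4 + 4608 * i ^ 4 * l ^ 5 + 4608 * i ^ 5
      + 14976 * i ^ 5 * l + 16576 * i ^ 5 * l ^ 2 + 7680 * i ^ 5 * l ^ 3 + 1280 * i ^ 5 * l ^ 4
      + 79464 * j + 474788 * j * l + 965016 * j * l ^ 2 + 972016 * j * l ^ 3
      + 545792 * j * l ^ 4 + 174016 * j * l ^ 5 + 29440 * j * l ^ 6 + 2048 * j * l ^ 7
      + 41328 * j ^ 2 + 198168 * j ^ 2 * l + 338864 * j ^ 2 * l ^ 2 + 283136 * j ^ 2 * l ^ 3
      + 125376 * j ^ 2 * l ^ 4 + 28288 * j ^ 2 * l ^ 5 + 2560 * j ^ 2 * l ^ 6 + 8064 * j ^ 3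
      + 30144 * j ^ 3 * l + 41472 * j ^ 3 * l ^ 2 + 27008 * j ^ 3 * l ^ 3 + 8448 * j ^ 3 * l ^ 4
      + 1024 * j ^ 3 * l ^ 5 + 269020 * l + 617388 * l ^ 2 + 680400 * l ^ 3 + 414832 * l ^ 4
      + 143808 * l ^ 5 + 26624 * l ^ 6 + 2048 * l ^ 7"
    unfolding spread_factor_def mass_factor_def q_def q'_def s_def c_def k_def m_def n_def by algebra
  also have "\<dots> \<ge> 0"
    by (intro add_nonneg_nonneg mult_nonneg_nonneg zero_le_power zero_le_numeral assms(1-3))
  finally show ?thesis by simp
qed

text \<open>A quantitative form of the case \<open>k = 2 m\<close>: once the ratio of the last two
  \<beta>'s is inserted, the left side measures the negative leading coefficient of \<Psi>.\<close>

lemma mass_factor_le_last: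
  fixes i j :: real
  assumes "i \<ge> 0" "j \<ge> 0"
  defines "m \<equiv> 2 + i" and "n \<equiv> 2 + i + j"
  defines "a \<equiv> 2 * m + 1" and "b \<equiv> 2 * n + 1"
  defines "s \<equiv> a * b" and "c \<equiv> a + b" and "k \<equiv> 2 * m"
  shows "(b - a + 2) * (a * b - a\<^sup>2 + 1) * (2 * a - 1)
           \<le> c * spread_factor s c k - k * mass_factor s c k"
proof -
  have "c * spread_factor s c k - k * mass_factor s c k
     - (b - a + 2) * (a * b - a\<^sup>2 + 1) * (2 * a - 1) =
     8370 + 18498 * i + 6052 * i * j + 816 * i * j ^ 2 + 16180 * i ^ 2 + 4048 * i ^ 2 * j
      + 400 * i ^ 2 * j ^ 2 + 7008 * i ^ 3 + 1184 * i ^ 3 * j + 64 * i ^ 3 * j ^ 2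
      + 1504 * i ^ 4 + 128 * i ^ 4 * j + 128 * i ^ 5 + 3330 * j + 540 * j ^ 2"
    unfolding spread_factor_def mass_factor_def s_def c_def k_def a_def b_def m_def n_def by algebra
  also have "\<dots> \<ge> 0"
    by (intro add_nonneg_nonneg mult_nonneg_nonneg zero_le_power zero_le_numeral assms(1-2))
  finally show ?thesis by simp
qed

text \<open>\<open>e\<close> is the constant coefficient of \<Psi>. The square on the left contains
  minus three times the linear coefficient, the last factor on the right is ninety times the
  quadratic one, and \<open>10 = 90 / 9\<close>; so the quadratic part has negative
  discriminant.\<close>

lemma discriminant_neg_ge_3:
  fixes i j :: real
  assumes "i \<ge> 0" "j \<ge> 0"
  defines "m \<equiv> 3 + i" and "n \<equiv> 3 + i + j"
  defines "s \<equiv> (2 * m + 1) * (2 * n + 1)" and "c \<equiv> 2 * m + 2 * n + 2" and "e \<equiv> 4 * m * n"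
  shows "10 * (3 * (2 * s + 1 - c) + (2 * c - 1) * e)\<^sup>2
           < 4 * e * ((c * spread_factor s c 2 - 2 * mass_factor s c 2) * e)"
proof -
  have "4 * e * ((c * spread_factor s c 2 - 2 * mass_factor s c 2) * e)
     - 10 * (3 * (2 * s + 1 - c) + (2 * c - 1) * e)\<^sup>2 =
     3016134 + 10610064 * i + 13115376 * i * j + 5690784 * i * j ^ 2 + 1025664 * i * j ^ 3
      + 62976 * i * j ^ 4 + 13115376 * i ^ 2 + 12296160 * i ^ 2 * j + 3933024 * i ^ 2 * j ^ 2
      + 486912 * i ^ 2 * j ^ 3 + 17408 * i ^ 2 * j ^ 4 + 8197440 * i ^ 3 + 5814720 * i ^ 3 * j
      + 1317888 * i ^ 3 * j ^ 2 + 100864 * i ^ 3 * j ^ 3 + 1536 * i ^ 3 * j ^ 4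
      + 2907360 * i ^ 4 + 1489920 * i ^ 4 * j + 215552 * i ^ 4 * j ^ 2 + 7680 * i ^ 4 * j ^ 3
      + 595968 * i ^ 5 + 198144 * i ^ 5 * j + 13824 * i ^ 5 * j ^ 2 + 66048 * i ^ 6
      + 10752 * i ^ 6 * j + 3072 * i ^ 7 + 5305032 * j + 3157272 * j ^ 2 + 796032 * j ^ 3
      + 73728 * j ^ 4"
    unfolding spread_factor_def mass_factor_def s_def c_def e_def m_def n_def by algebra
  also have "\<dots> > 0"
    by (intro add_pos_nonneg add_nonneg_nonneg mult_nonneg_nonneg zero_le_power zero_le_numeral
        zero_less_numeral assms(1-2))
  finally show ?thesis by simp
qed

text \<open>The shift starts at \<open>n = 3\<close> because the polynomial below is negative at
  \<open>j = - 1\<close>, that is at \<open>n = 2\<close>.\<close>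

lemma discriminant_neg_2:
  fixes j :: real
  assumes "j \<ge> 0"
  defines "m \<equiv> 2" and "n \<equiv> 3 + j"
  defines "s \<equiv> (2 * m + 1) * (2 * n + 1)" and "c \<equiv> 2 * m + 2 * n + 2" and "e \<equiv> 4 * m * n"
  shows "10 * (3 * (2 * s + 1 - c) + (2 * c - 1) * e)\<^sup>2
           < 4 * e * ((c * spread_factor s c 2 - 2 * mass_factor s c 2) * e)"
proof -
  have "4 * e * ((c * spread_factor s c 2 - 2 * mass_factor s c 2) * e)
     - 10 * (3 * (2 * s + 1 - c) + (2 * c - 1) * e)\<^sup>2 =
     146070 + 1139112 * j + 935384 * j ^ 2 + 270592 * j ^ 3 + 26624 * j ^ 4"
    unfolding spread_factor_def mass_factor_def s_def c_def e_def m_def n_def by algebra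
  also have "\<dots> > 0"
    by (intro add_pos_nonneg add_nonneg_nonneg mult_nonneg_nonneg zero_le_power zero_le_numeral
        zero_less_numeral assms(1))
  finally show ?thesis by simp
qed

section \<open>The coefficients of \<Psi>\<close>

context moment_pair
begin

definition \<beta> :: "nat \<Rightarrow> real" where "\<beta> i = coeff B i"

text \<open>For the weights \<open>\<beta> i * \<beta> (k - i)\<close>, whose total mass is
  \<open>w k\<close>, this is the unnormalised second moment of the index difference.\<close>

definition spread :: "nat \<Rightarrow> real" where
  "spread k = (\<Sum>i\<le>k. \<beta> i * \<beta> (k - i) * (real i - real (k - i))\<^sup>2)"

definition \<Psi> :: "real poly" where
  "\<Psi> = smult s ([:1, -1:] * (A * A)) + smult c ([:-1, s + 1:] * (A * B))
       - [:-1, (s + 1)\<^sup>2:] * (B * B)"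

lemma \<beta>_eq: "\<beta> i = even_coeff m n i / (2 * real i + 1)"
  by (simp add: \<beta>_def coeff_odd_poly)

lemma \<beta>_nonneg: "\<beta> i \<ge> 0"
  by (simp add: \<beta>_eq even_coeff_nonneg)

lemma coeff_A_\<beta>: "coeff A i = (2 * real i + 1) * \<beta> i"
proof -
  have "2 * real i + 1 \<noteq> 0" using of_nat_0_le_iff[of i, where ?'a = real] by linarith
  then show ?thesis by (simp add: \<beta>_eq coeff_even_poly)
qed

lemma \<beta>_Suc: "(real i + 1) * (2 * real i + 3) * \<beta> (Suc i) = 2 * (real m - real i) * (real n - real i) * \<beta> i"
proof -
  have "even_coeff m n (Suc i) = (2 * real i + 3) * \<beta> (Suc i)"
    using coeff_A_\<beta>[of "Suc i"] by (simp add: coeff_even_poly algebra_simps)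
  moreover have "even_coeff m n i = (2 * real i + 1) * \<beta> i"
    using coeff_A_\<beta>[of i] by (simp add: coeff_even_poly)
  ultimately have eq: "(2 * real i + 1) * (2 * ((real i + 1) * (2 * real i + 3) * \<beta> (Suc i))) =
      (2 * real i + 1) * (2 * (2 * (real m - real i) * (real n - real i) * \<beta> i))"
    using even_coeff_Suc[of i m n] by algebra
  have "2 * real i + 1 \<noteq> 0" using of_nat_0_le_iff[of i, where ?'a = real] by linarith
  with eq show ?thesis by (metis mult_cancel_left zero_neq_numeral)
qed

lemma w_eq: "w k = (\<Sum>i\<le>k. \<beta> i * \<beta> (k - i))"
  by (simp add: w_def coeff_mult \<beta>_def)

lemma w_nonneg: "w k \<ge> 0"
  by (auto simp: w_eq intro!: sum_nonneg mult_nonneg_nonneg \<beta>_nonneg)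

text \<open>Rests on \<open>(2 i + 1) (2 (k - i) + 1) = (k + 1)^2 - (2 i - k)^2\<close>.\<close>

lemma u_eq: "u k = (real k + 1)\<^sup>2 * w k - spread k"
proof -
  have "u k = (\<Sum>i\<le>k. (2 * real i + 1) * \<beta> i * ((2 * real (k - i) + 1) * \<beta> (k - i)))"
    by (simp add: u_def coeff_mult coeff_A_\<beta>)
  also have "\<dots> = (\<Sum>i\<le>k. (real k + 1)\<^sup>2 * (\<beta> i * \<beta> (k - i))
                    - \<beta> i * \<beta> (k - i) * (real i - real (k - i))\<^sup>2)"
  proof (rule sum.cong)
    fix i assume "i \<in> {..k}"
    then have k: "real k = real i + real (k - i)" by simp
    show "(2 * real i + 1) * \<beta> i * ((2 * real (k - i) + 1) * \<beta> (k - i)) =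
        (real k + 1)\<^sup>2 * (\<beta> i * \<beta> (k - i)) - \<beta> i * \<beta> (k - i) * (real i - real (k - i))\<^sup>2"
      unfolding k by algebra
  qed simp
  also have "\<dots> = (real k + 1)\<^sup>2 * w k - spread k"
    by (simp add: sum_subtractf sum_distrib_left w_eq spread_def)
  finally show ?thesis .
qed

lemma coeff_\<Psi>_Suc:
  "coeff \<Psi> (Suc j) = s * (u (Suc j) - u j) + c * ((s + 1) * v j - v (Suc j))
     + w (Suc j) - (s + 1)\<^sup>2 * w j"
  by (simp add: \<Psi>_def u_def v_def w_def algebra_simps)

text \<open>The recurrences reduce \<open>u\<close>, \<open>v\<close> and \<open>w\<close> at
  \<open>Suc j\<close> to index \<open>j\<close>; their factors \<open>k\<close>,
  \<open>2 k + 1\<close> and \<open>k + 1\<close> are the denominators cleared on the left. Then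
  \<open>u j\<close> and \<open>v j\<close> are rewritten through \<open>w j\<close> and
  \<open>spread j\<close>.\<close>

lemma coeff_\<Psi>:
  assumes k: "k = real j + 1"
  shows "k * (2 * k + 1) * (k + 1) * coeff \<Psi> (Suc j) =
    c * spread_factor s c k * spread j - k * mass_factor s c k * w j"
proof -
  have u: "u j = k\<^sup>2 * w j - spread j" and v: "v j = k * w j"
    using u_eq v_w by (simp_all add: k)
  have u': "k * u (Suc j) = s * v j - (c - k) * u j"
    using u_rec[of j] by (simp add: k)
  have v': "(2 * k + 1) * v (Suc j) = u (Suc j) - u j + s * w j + (2 * k - c) * v j"
    using v_rec[of j] by (simp add: k algebra_simps)
  have w': "(k + 1) * w (Suc j) = v (Suc j)"
    using v_w[of "Suc j"] by (simp add: k)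
  have "k * (2 * k + 1) * (k + 1) * coeff \<Psi> (Suc j) =
      s * (2 * k + 1) * (k + 1) * (k * u (Suc j)) - c * k * (k + 1) * ((2 * k + 1) * v (Suc j))
      + k * (2 * k + 1) * ((k + 1) * w (Suc j))
      + k * (2 * k + 1) * (k + 1) * (c * (s + 1) * v j - s * u j - (s + 1)\<^sup>2 * w j)"
    unfolding coeff_\<Psi>_Suc by algebra
  also have "\<dots> = s * (2 * k + 1) * (k + 1) * (k * u (Suc j))
      - (c * (k + 1) - 1) * (k * u (Suc j) + k * (s * w j + (2 * k - c) * v j - u j))
      + k * (2 * k + 1) * (k + 1) * (c * (s + 1) * v j - s * u j - (s + 1)\<^sup>2 * w j)"
    using v' w' by algebra
  also have "\<dots> = c * spread_factor s c k * spread j - k * mass_factor s c k * w j"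
    unfolding u' u v spread_factor_def mass_factor_def by algebra
  finally show ?thesis .
qed

text \<open>The difference of the two indices is odd, so its square is at least 1.\<close>

lemma w_le_spread_odd:
  assumes "odd k" shows "w k \<le> spread k"
  unfolding w_eq spread_def
proof (rule sum_mono)
  fix i assume "i \<in> {..k}"
  with assms have "int i - int (k - i) \<noteq> 0" by (auto simp: of_nat_diff) presburger
  then have "1 \<le> (int i - int (k - i))\<^sup>2"
    by (metis int_one_le_iff_zero_less zero_less_power2)
  then have "(1::real) \<le> of_int ((int i - int (k - i))\<^sup>2)" by (simp only: of_int_1_le_iff)
  then have "1 \<le> (real i - real (k - i))\<^sup>2" by (simp only: of_int_power of_int_diff of_int_of_nat_eq)
  then show "\<beta> i * \<beta> (k - i) \<le> \<beta> i * \<beta> (k - i) * (real i - real (k - i))\<^sup>2"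
    using mult_left_mono[of 1 "(real i - real (k - i))\<^sup>2" "\<beta> i * \<beta> (k - i)"] \<beta>_nonneg by simp
qed

text \<open>The index difference is now even: it vanishes only at the centre \<open>i = l\<close>,
  and elsewhere its square is at least 4.\<close>

lemma w_diff_le_spread_even: "4 * (w (2 * l) - (\<beta> l)\<^sup>2) \<le> spread (2 * l)"
proof -
  have l: "l \<in> {..2 * l}" by simp
  have "4 * (w (2 * l) - (\<beta> l)\<^sup>2) = (\<Sum>i\<in>{..2 * l} - {l}. 4 * (\<beta> i * \<beta> (2 * l - i)))"
    unfolding w_eq using sum.remove[OF _ l, of "\<lambda>i. \<beta> i * \<beta> (2 * l - i)"]
    by (simp add: power2_eq_square sum_distrib_left)
  also have "\<dots> \<le> (\<Sum>i\<in>{..2 * l} - {l}. \<beta> i * \<beta> (2 * l - i) * (real i - real (2 * l - i))\<^sup>2)"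
  proof (rule sum_mono)
    fix i assume i: "i \<in> {..2 * l} - {l}"
    then have "(int i - int l) \<noteq> 0" by simp
    then have "1 \<le> (int i - int l)\<^sup>2" by (metis int_one_le_iff_zero_less zero_less_power2)
    then have "(1::real) \<le> of_int ((int i - int l)\<^sup>2)" by (simp only: of_int_1_le_iff)
    then have "1 \<le> (real i - real l)\<^sup>2" by (simp only: of_int_power of_int_diff of_int_of_nat_eq)
    moreover have "real i - real (2 * l - i) = 2 * (real i - real l)"
      using i by (simp add: of_nat_diff)
    then have "(real i - real (2 * l - i))\<^sup>2 = 4 * (real i - real l)\<^sup>2"
      by (simp only: power_mult_distrib) simp
    ultimately have "4 \<le> (real i - real (2 * l - i))\<^sup>2" by linarith
    then show "4 * (\<beta> i * \<beta> (2 * l - i)) \<le> \<beta> i * \<beta> (2 * l - i) * (real i - real (2 * l - i))\<^sup>2"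
      using mult_left_mono[of 4 "(real i - real (2 * l - i))\<^sup>2" "\<beta> i * \<beta> (2 * l - i)"] \<beta>_nonneg
      by simp
  qed
  also have "\<dots> \<le> spread (2 * l)"
    unfolding spread_def by (intro sum_mono2) (auto intro!: mult_nonneg_nonneg \<beta>_nonneg)
  finally show ?thesis .
qed

text \<open>Keeps the three central terms only. As the neighbouring product is a fixed multiple of
  the central square, this bounds the one term that \<open>spread\<close> does not see.\<close>

lemma \<beta>_neighbours_le_w: "(\<beta> (Suc l))\<^sup>2 + 2 * (\<beta> l * \<beta> (l + 2)) \<le> w (2 * Suc l)"
proof -
  have "(\<beta> (Suc l))\<^sup>2 + 2 * (\<beta> l * \<beta> (l + 2)) = (\<Sum>i\<in>{l, Suc l, l + 2}. \<beta> i * \<beta> (2 * Suc l - i))"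
    by (simp add: power2_eq_square mult.commute)
  also have "\<dots> \<le> w (2 * Suc l)"
    unfolding w_eq by (rule sum_mono2) (auto intro!: mult_nonneg_nonneg \<beta>_nonneg)
  finally show ?thesis .
qed

lemma mass_le_spread_factor:
  assumes "1 \<le> m" "m \<le> n" "1 \<le> j" "j < 2 * m" and k: "k = real j + 1"
  shows "spread_factor s c k \<ge> 0" "k * mass_factor s c k * w j \<le> c * spread_factor s c k * spread j"
proof -
  show sf: "spread_factor s c k \<ge> 0"
  proof -
    have "c \<le> 2 * s"
      using assms(1,2) mult_mono[of 1 b 1 a] unfolding c_def s_def a_def b_def
      by (simp add: algebra_simps)
    moreover have "s \<ge> 0" by (simp add: s_def a_def b_def)
    moreover have "2 \<le> 2 * k + 1" using k by simp
    ultimately have "c * (k + 1) \<le> ((2 * k + 1) * s) * (k + 1)"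
      using k by (intro mult_right_mono order.trans[OF \<open>c \<le> 2 * s\<close>] mult_right_mono) auto
    then show ?thesis unfolding spread_factor_def by (simp add: mult_ac)
  qed
  have c0: "c \<ge> 0" by (simp add: c_def a_def b_def)
  show "k * mass_factor s c k * w j \<le> c * spread_factor s c k * spread j"
  proof (cases "odd j")
    case True
    then obtain l where j: "j = 2 * l + 1" by (rule oddE)
    have "l + 1 \<le> m" using assms(4) j by simp
    have "k * mass_factor s c k \<le> c * spread_factor s c k"
    proof -
      define i h where "i = real (m - (l + 1))" and "h = real (n - m)"
      have m: "real m = real l + 1 + i" and n: "real n = real l + 1 + i + h"
        using \<open>l + 1 \<le> m\<close> assms(2) by (simp_all add: i_def h_def)
      have "k = 2 * real l + 2" by (simp add: k j)
      moreover have "s = (2 * (real l + 1 + i) + 1) * (2 * (real l + 1 + i + h) + 1)"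
        and "c = 2 * (real l + 1 + i) + 2 * (real l + 1 + i + h) + 2"
        by (simp_all add: s_def c_def a_def b_def m n)
      moreover have "i \<ge> 0" "h \<ge> 0" by (simp_all add: i_def h_def)
      ultimately show ?thesis
        using mass_factor_le_even[of i h "real l"] by (simp only: of_nat_0_le_iff)
    qed
    then have "k * mass_factor s c k * w j \<le> c * spread_factor s c k * w j"
      using w_nonneg by (rule mult_right_mono)
    also have "\<dots> \<le> c * spread_factor s c k * spread j"
      using w_le_spread_odd[OF True] sf c0 by (intro mult_left_mono) auto
    finally show ?thesis .
  next
    case False
    then obtain l' where l': "j = 2 * l'" by blast
    with assms(3) obtain l where j: "j = 2 * Suc l" by (cases l') auto
    have lm: "l + 2 \<le> m" using assms(4) j by simp
    define q where "q = (real m - real (l + 1)) * (real n - real (l + 1)) * (real l + 1) * (2 * real l + 3)"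
    define q' where "q' = (real m - real l) * (real n - real l) * (real l + 2) * (2 * real l + 5)"
    have q: "q \<ge> 0" "q' > 0" unfolding q_def q'_def using lm assms(2) by auto
    have le: "(q' + 2 * q) * (k * mass_factor s c k) \<le> 8 * q * (c * spread_factor s c k)"
    proof -
      define i h where "i = real (m - (l + 2))" and "h = real (n - m)"
      have m: "real m = real l + 2 + i" and n: "real n = real l + 2 + i + h"
        using lm assms(2) by (simp_all add: i_def h_def)
      have "k = 2 * real l + 3" by (simp add: k j)
      moreover have "s = (2 * (real l + 2 + i) + 1) * (2 * (real l + 2 + i + h) + 1)"
        and "c = 2 * (real l + 2 + i) + 2 * (real l + 2 + i + h) + 2"
        by (simp_all add: s_def c_def a_def b_def m n)
      moreover have "q = (1 + i) * (1 + i + h) * (real l + 1) * (2 * real l + 3)"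
        and "q' = (2 + i) * (2 + i + h) * (real l + 2) * (2 * real l + 5)"
        by (simp_all add: q_def q'_def m n)
      moreover have "i \<ge> 0" "h \<ge> 0" by (simp_all add: i_def h_def)
      ultimately show ?thesis
        using mass_factor_le_odd[of i h "real l"] by (simp only: of_nat_0_le_iff)
    qed
    have ratio: "q' * (\<beta> l * \<beta> (l + 2)) = q * (\<beta> (Suc l))\<^sup>2"
    proof -
      have "(real l + 1) * (2 * real l + 3) * \<beta> (Suc l) = 2 * (real m - real l) * (real n - real l) * \<beta> l"
        by (rule \<beta>_Suc)
      moreover have "(real l + 2) * (2 * real l + 5) * \<beta> (l + 2)
          = 2 * (real m - real (l + 1)) * (real n - real (l + 1)) * \<beta> (Suc l)"
        using \<beta>_Suc[of "Suc l"] by (simp add: algebra_simps)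
      ultimately show ?thesis unfolding q_def q'_def by algebra
    qed
    have "(q' + 2 * q) * (\<beta> (Suc l))\<^sup>2 \<le> q' * w j"
      using mult_left_mono[OF \<beta>_neighbours_le_w[of l], of q'] q ratio by (simp add: j algebra_simps)
    moreover have "4 * (q' + 2 * q) * (w j - (\<beta> (Suc l))\<^sup>2) \<le> (q' + 2 * q) * spread j"
      using mult_left_mono[OF w_diff_le_spread_even[of "Suc l"], of "q' + 2 * q"] q
      unfolding j by (simp only: mult_ac)
    \<comment> \<open>Four times the bound on the central square, subtracted from the spread
      estimate, leaves \<open>4 (q' + 2 q) w - 4 q' w = 8 q w\<close>.\<close>
    ultimately have sp: "8 * q * w j \<le> (q' + 2 * q) * spread j"
      by (simp add: algebra_simps)
    have "(q' + 2 * q) * (k * mass_factor s c k * w j) \<le> 8 * q * (c * spread_factor s c k) * w j"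
      using mult_right_mono[OF le w_nonneg[of j]] by (simp add: mult_ac)
    also have "\<dots> = (c * spread_factor s c k) * (8 * q * w j)" by (simp add: mult_ac)
    also have "\<dots> \<le> (c * spread_factor s c k) * ((q' + 2 * q) * spread j)"
      using sp sf c0 by (intro mult_left_mono) auto
    also have "\<dots> = (q' + 2 * q) * (c * spread_factor s c k * spread j)" by (simp add: mult_ac)
    finally show ?thesis
      using q by (subst (asm) mult_le_cancel_left_pos) auto
  qed
qed

lemma coeff_\<Psi>_nonneg:
  assumes "1 \<le> m" "m \<le> n" "2 \<le> k" "k \<le> 2 * m"
  shows "coeff \<Psi> k \<ge> 0"
proof -
  obtain j where j: "k = Suc j" using assms(3) by (cases k) auto
  have "0 \<le> (real j + 1) * (2 * (real j + 1) + 1) * (real j + 1 + 1) * coeff \<Psi> (Suc j)"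
    unfolding coeff_\<Psi>[OF refl]
    using mass_le_spread_factor(2)[OF assms(1,2), of j] assms(3,4) j by simp
  moreover have "(real j + 1) * (2 * (real j + 1) + 1) * (real j + 1 + 1) > 0"
    by (intro mult_pos_pos add_nonneg_pos) auto
  ultimately show ?thesis
    unfolding j by (subst (asm) zero_le_mult_iff) (auto simp only: not_less[symmetric] dest: less_asym)
qed

end

section \<open>Positivity of \<Psi> on the unit interval\<close>

lemma quadratic_pos:
  fixes p q r x :: real
  assumes "p > 0" "q\<^sup>2 < 4 * p * r"
  shows "p + q * x + r * x\<^sup>2 > 0"
proof (cases "x = 0")
  case False
  have "4 * p * (p + q * x + r * x\<^sup>2) = (2 * p + q * x)\<^sup>2 + (4 * p * r - q\<^sup>2) * x\<^sup>2"
    by algebra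
  also have "\<dots> > 0"
    using False assms(2) by (intro add_nonneg_pos mult_pos_pos) auto
  finally show ?thesis using assms(1) by (simp add: zero_less_mult_iff)
qed (use assms in simp)

context moment_pair
begin

lemma \<beta>_0 [simp]: "\<beta> 0 = 1"
  by (simp add: \<beta>_eq)

lemma \<beta>_eq_0: "m < i \<Longrightarrow> \<beta> i = 0"
  by (simp add: \<beta>_eq even_coeff_eq_0)

lemma \<beta>_1: "\<beta> 1 = 2 * real m * real n / 3"
  using \<beta>_Suc[of 0] by simp

lemma degree_A: "degree A \<le> m"
  by (rule degree_le) (simp add: coeff_even_poly even_coeff_eq_0)

lemma degree_B: "degree B \<le> m"
  by (rule degree_le) (simp add: coeff_odd_poly even_coeff_eq_0)

lemma coeff_\<Psi>_eq_0:
  assumes "2 * m + 1 < k" shows "coeff \<Psi> k = 0"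
proof -
  obtain j where k: "k = Suc j" and j: "2 * m < j" using assms by (cases k) auto
  have "degree (A * A) \<le> 2 * m" "degree (A * B) \<le> 2 * m" "degree (B * B) \<le> 2 * m"
    using degree_mult_le[of A A] degree_mult_le[of A B] degree_mult_le[of B B] degree_A degree_B
    by linarith+
  then show ?thesis
    using j unfolding k coeff_\<Psi>_Suc u_def v_def w_def by (simp add: coeff_eq_0)
qed

lemma poly_\<Psi>_sum: "poly \<Psi> x = (\<Sum>k\<le>2 * m + 1. coeff \<Psi> k * x ^ k)"
proof -
  have "degree \<Psi> \<le> 2 * m + 1" by (rule degree_le) (use coeff_\<Psi>_eq_0 in auto)
  then show ?thesis
    unfolding poly_altdef by (intro sum.mono_neutral_left) (auto simp: coeff_eq_0)
qed

lemma s_minus_c: "s - c + 1 = 4 * real m * real n"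
  by (simp add: s_def c_def a_def b_def algebra_simps)

lemma coeff_\<Psi>_0: "coeff \<Psi> 0 = 4 * real m * real n"
  unfolding s_minus_c[symmetric]
  by (simp add: \<Psi>_def coeff_mult coeff_even_poly coeff_odd_poly)

text \<open>At \<open>j = 0\<close> the spread is 0, so only the mass term survives, with a negative
  sign.\<close>

lemma coeff_\<Psi>_1:
  "3 * coeff \<Psi> 1 = - (3 * (2 * s + 1 - c) + (2 * c - 1) * (4 * real m * real n))"
proof -
  have "6 * coeff \<Psi> 1 = - mass_factor s c 1"
    using coeff_\<Psi>[of 1 0] by (simp add: spread_def w_eq)
  then show ?thesis
    unfolding mass_factor_def s_minus_c[symmetric] by (simp add: algebra_simps)
qed

text \<open>At index 1 mass and spread coincide, both being \<open>2 * \<beta> 1\<close>.\<close>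

lemma coeff_\<Psi>_2:
  "90 * coeff \<Psi> 2 = (c * spread_factor s c 2 - 2 * mass_factor s c 2) * (4 * real m * real n)"
proof -
  have "{..1::nat} = {0, 1}" by auto
  then have w: "w 1 = 4 * real m * real n / 3" and sp: "spread 1 = 4 * real m * real n / 3"
    by (simp_all add: w_eq spread_def \<beta>_1[unfolded One_nat_def])
  have "30 * coeff \<Psi> 2 = c * spread_factor s c 2 * (4 * real m * real n / 3)
      - 2 * mass_factor s c 2 * (4 * real m * real n / 3)"
    using coeff_\<Psi>[of 2 1] unfolding w sp by (simp add: numeral_2_eq_2)
  then show ?thesis by (simp add: field_simps)
qed

text \<open>At index \<open>2 m\<close> only the central term survives, so the spread vanishes. With
  \<open>k = a\<close> the factor \<open>s - c k + k^2 = (k - a) (k - b)\<close> of the mass weight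
  is 0.\<close>

lemma coeff_\<Psi>_last: "coeff \<Psi> (2 * m + 1) = - (a * b - a\<^sup>2 + 1) * (\<beta> m)\<^sup>2"
proof -
  have z: "\<beta> i * \<beta> (2 * m - i) = 0" if "i \<in> {..2 * m} - {m}" for i
    using that \<beta>_eq_0[of i] \<beta>_eq_0[of "2 * m - i"] by (cases "i < m") auto
  have "w (2 * m) = (\<Sum>i\<in>{m}. \<beta> i * \<beta> (2 * m - i))"
    unfolding w_eq by (rule sum.mono_neutral_right) (use z in auto)
  then have w: "w (2 * m) = (\<beta> m)\<^sup>2" by (simp add: power2_eq_square)
  have "spread (2 * m) = (\<Sum>i\<in>{m}. \<beta> i * \<beta> (2 * m - i) * (real i - real (2 * m - i))\<^sup>2)"
    unfolding spread_def by (rule sum.mono_neutral_right) (use z in auto)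
  then have sp: "spread (2 * m) = 0" by simp
  have "a = real (2 * m) + 1" by (simp add: a_def)
  from coeff_\<Psi>[OF this]
  have "a * (2 * a + 1) * (a + 1) * coeff \<Psi> (Suc (2 * m)) = - a * mass_factor s c a * (\<beta> m)\<^sup>2"
    unfolding w sp by simp
  also have "\<dots> = a * (2 * a + 1) * (a + 1) * (- (a * b - a\<^sup>2 + 1) * (\<beta> m)\<^sup>2)"
    unfolding mass_factor_def s_def c_def by algebra
  finally show ?thesis
    by (subst (asm) mult_left_cancel) (auto simp: a_def)
qed

text \<open>At index \<open>2 m - 1\<close> only two terms survive, with index difference 1 in
  absolute value, so \<open>w\<close> and \<open>spread\<close> agree. The ratio of the last two
  \<beta>'s reduces the claim to \<open>mass_factor_le_last\<close>.\<close>

lemma coeff_\<Psi>_last_two: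
  assumes "2 \<le> m" "m \<le> n"
  shows "coeff \<Psi> (2 * m) + coeff \<Psi> (2 * m + 1) \<ge> 0"
proof -
  obtain l where l: "m = Suc l" using assms by (cases m) auto
  have z: "\<beta> i * \<beta> (2 * l + 1 - i) = 0" if "i \<in> {..2 * l + 1} - {l, Suc l}" for i
    using that \<beta>_eq_0[of i] \<beta>_eq_0[of "2 * l + 1 - i"] l by (cases "i < l") auto
  have w: "w (2 * l + 1) = (\<Sum>i\<in>{l, Suc l}. \<beta> i * \<beta> (2 * l + 1 - i))"
    unfolding w_eq by (rule sum.mono_neutral_right) (use z in auto)
  have sp: "spread (2 * l + 1) = (\<Sum>i\<in>{l, Suc l}. \<beta> i * \<beta> (2 * l + 1 - i) * (real i - real (2 * l + 1 - i))\<^sup>2)"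
    unfolding spread_def by (rule sum.mono_neutral_right) (use z in auto)
  have w: "w (2 * l + 1) = 2 * \<beta> l * \<beta> m" and sp: "spread (2 * l + 1) = 2 * \<beta> l * \<beta> m"
    unfolding w sp by (simp_all add: l of_nat_diff)
  define k where "k = real (2 * m)"
  have m: "real m = real l + 1" by (simp add: l)
  have k: "k = a - 1" "k = real (2 * l + 1) + 1" by (simp_all add: k_def a_def m)
  have \<beta>: "(b - a + 2) * (2 * \<beta> l) = (a - 1) * a * \<beta> m"
    using \<beta>_Suc[of l] unfolding l[symmetric] a_def b_def m by (simp add: algebra_simps)
  have a: "a > 1" using assms by (simp add: a_def)
  have "(a * b - a\<^sup>2 + 1) * (\<beta> m)\<^sup>2 * (k * (2 * k + 1) * (k + 1)) =
      (b - a + 2) * (a * b - a\<^sup>2 + 1) * (2 * a - 1) * (2 * \<beta> l * \<beta> m)"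
    using \<beta> unfolding k(1) by algebra
  also have "\<dots> \<le> (c * spread_factor s c k - k * mass_factor s c k) * (2 * \<beta> l * \<beta> m)"
  proof (rule mult_right_mono)
    define i j where "i = real (m - 2)" and "j = real (n - m)"
    have m: "real m = 2 + i" and n: "real n = real m + j"
      using assms by (simp_all add: i_def j_def)
    have "i \<ge> 0" "j \<ge> 0" by (simp_all add: i_def j_def)
    from mass_factor_le_last[OF this] show "(b - a + 2) * (a * b - a\<^sup>2 + 1) * (2 * a - 1)
        \<le> c * spread_factor s c k - k * mass_factor s c k"
      by (simp only: m[symmetric] n[symmetric] a_def[symmetric] b_def[symmetric]
          s_def[symmetric] c_def[symmetric] k_def of_nat_mult of_nat_numeral)
  qed (use \<beta>_nonneg in simp)
  also have "\<dots> = coeff \<Psi> (2 * m) * (k * (2 * k + 1) * (k + 1))"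
    using coeff_\<Psi>[OF k(2)] l unfolding w sp by (simp add: algebra_simps)
  finally have "(a * b - a\<^sup>2 + 1) * (\<beta> m)\<^sup>2 \<le> coeff \<Psi> (2 * m)"
    by (rule mult_right_le_imp_le) (use a k(1) in \<open>auto intro!: mult_pos_pos\<close>)
  then show ?thesis unfolding coeff_\<Psi>_last by linarith
qed

text \<open>Three blocks are treated separately: the quadratic part by its discriminant, the middle
  terms by their signs, and the last two terms jointly.\<close>

lemma \<Psi>_pos_ge_2:
  assumes "2 \<le> m" "m \<le> n" "3 \<le> n" "0 \<le> x" "x \<le> 1"
  shows "poly \<Psi> x > 0"
proof -
  let ?p = "coeff \<Psi>"
  have "10 * (3 * ?p 1)\<^sup>2 < 4 * (4 * real m * real n) * (90 * ?p 2)"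
  proof (cases "m = 2")
    case True
    define j where "j = real (n - 3)"
    have m: "real m = 2" and n: "real n = 3 + j" using True assms(3) by (simp_all add: j_def)
    have s: "s = (2 * real m + 1) * (2 * real n + 1)" and c: "c = 2 * real m + 2 * real n + 2"
      by (simp_all add: s_def c_def a_def b_def)
    have "j \<ge> 0" by (simp add: j_def)
    from discriminant_neg_2[OF this] show ?thesis
      unfolding coeff_\<Psi>_1 coeff_\<Psi>_2 power2_minus unfolding s c m n .
  next
    case False
    define i j where "i = real (m - 3)" and "j = real (n - m)"
    have m: "real m = 3 + i" and n: "real n = 3 + i + j"
      using False assms(1,2) by (simp_all add: i_def j_def)
    have s: "s = (2 * real m + 1) * (2 * real n + 1)" and c: "c = 2 * real m + 2 * real n + 2"
      by (simp_all add: s_def c_def a_def b_def)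
    have "i \<ge> 0" "j \<ge> 0" by (simp_all add: i_def j_def)
    from discriminant_neg_ge_3[OF this] show ?thesis
      unfolding coeff_\<Psi>_1 coeff_\<Psi>_2 power2_minus unfolding s c m n .
  qed
  then have "(?p 1)\<^sup>2 < 4 * ?p 0 * ?p 2"
    by (simp add: coeff_\<Psi>_0 power_mult_distrib)
  moreover have "?p 0 > 0" using assms by (simp add: coeff_\<Psi>_0)
  ultimately have "?p 0 + ?p 1 * x + ?p 2 * x\<^sup>2 > 0" by (rule quadratic_pos[rotated])
  moreover have "(\<Sum>k=3..<2 * m. ?p k * x ^ k) \<ge> 0"
    using assms by (intro sum_nonneg mult_nonneg_nonneg coeff_\<Psi>_nonneg) auto
  moreover have "?p (2 * m) * x ^ (2 * m) + ?p (2 * m + 1) * x ^ (2 * m + 1) \<ge> 0"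
  proof -
    have "?p (2 * m + 1) \<le> 0"
    proof -
      have "a * b - a\<^sup>2 + 1 = a * (b - a) + 1" by algebra
      also have "\<dots> \<ge> 0" using assms by (simp add: a_def b_def)
      finally have "0 \<le> (a * b - a\<^sup>2 + 1) * (\<beta> m)\<^sup>2" by simp
      then show ?thesis unfolding coeff_\<Psi>_last by linarith
    qed
    \<comment> \<open>The leading coefficient is nonpositive and \<open>x \<le> 1\<close>, so the
      last two terms are at least the sum of their coefficients times
      \<open>x ^ (2 * m)\<close>.\<close>
    then have "?p (2 * m + 1) * 1 \<le> ?p (2 * m + 1) * x"
      using assms by (intro mult_left_mono_neg) auto
    then have "0 \<le> (?p (2 * m) + ?p (2 * m + 1) * x) * x ^ (2 * m)"
      using coeff_\<Psi>_last_two[OF assms(1,2)] assms(4) by (intro mult_nonneg_nonneg) auto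
    then show ?thesis by (simp add: algebra_simps)
  qed
  moreover have "poly \<Psi> x = ?p 0 + ?p 1 * x + ?p 2 * x\<^sup>2 + (\<Sum>k=3..<2 * m. ?p k * x ^ k)
      + (?p (2 * m) * x ^ (2 * m) + ?p (2 * m + 1) * x ^ (2 * m + 1))"
  proof -
    have "{..2 * m + 1} = {0, 1, 2} \<union> {3..<2 * m} \<union> {2 * m, 2 * m + 1}" using assms(1) by auto
    then have "poly \<Psi> x = (\<Sum>k\<in>{0, 1, 2} \<union> {3..<2 * m} \<union> {2 * m, 2 * m + 1}. ?p k * x ^ k)"
      by (simp only: poly_\<Psi>_sum)
    also have "\<dots> = (\<Sum>k\<in>{0, 1, 2}. ?p k * x ^ k) + (\<Sum>k=3..<2 * m. ?p k * x ^ k)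
        + (\<Sum>k\<in>{2 * m, 2 * m + 1}. ?p k * x ^ k)"
      using assms(1) by (subst sum.union_disjoint; (subst sum.union_disjoint)?) auto
    finally show ?thesis by simp
  qed
  ultimately show ?thesis by linarith
qed

text \<open>The cubic coefficient is nonpositive, so replacing one factor \<open>x\<close> of the
  cubic term by an upper bound leaves a quadratic minorant: the bound is \<open>1 / 3\<close> on the
  left piece and 1 on the right one.\<close>

lemma \<Psi>_pos_1:
  assumes "m = 1" "5 \<le> n" "0 \<le> x" "x \<le> 1"
  shows "poly \<Psi> x > 0"
proof -
  let ?p = "coeff \<Psi>"
  define y where "y = real n - 5"
  have m: "real m = 1" using assms(1) by simp
  have y: "y \<ge> 0" and n: "real n = 5 + y" using assms by (simp_all add: y_def)
  have sc: "s = 3 * (11 + 2 * y)" "c = 14 + 2 * y" "a = 3" "b = 11 + 2 * y"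
    by (simp_all add: s_def c_def a_def b_def m n)
  have p0: "?p 0 = 20 + 4 * y" by (simp add: coeff_\<Psi>_0 m n)
  have p1: "3 * ?p 1 = - (699 + 218 * y + 16 * y\<^sup>2)"
    unfolding coeff_\<Psi>_1 unfolding sc n m by simp algebra
  have "90 * ?p 2 = 74200 + 40840 * y + 7600 * y\<^sup>2 + 480 * y ^ 3"
    unfolding coeff_\<Psi>_2 spread_factor_def mass_factor_def unfolding sc n m by simp algebra
  then have p2: "9 * ?p 2 = 7420 + 4084 * y + 760 * y\<^sup>2 + 48 * y ^ 3" by simp
  have p3: "9 * ?p 3 = - (2500 + 1600 * y + 340 * y\<^sup>2 + 24 * y ^ 3)"
  proof -
    have 3: "2 * m + 1 = 3" and \<beta>: "\<beta> m = 2 * (5 + y) / 3" using assms(1) \<beta>_1 n by simp_all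
    have "?p 3 = - (3 * (11 + 2 * y) - 3\<^sup>2 + 1) * (2 * (5 + y) / 3)\<^sup>2"
      using coeff_\<Psi>_last unfolding 3 \<beta> sc by (simp add: algebra_simps)
    then show ?thesis by (simp add: power2_eq_square power3_eq_cube algebra_simps)
  qed
  have "?p 3 \<le> 0"
  proof -
    have "2500 + 1600 * y + 340 * y\<^sup>2 + 24 * y ^ 3 \<ge> 0" using y by simp
    with p3 show ?thesis by linarith
  qed
  have expand: "poly \<Psi> x = ?p 0 + ?p 1 * x + ?p 2 * x\<^sup>2 + ?p 3 * x ^ 3"
  proof -
    have "{..2 * m + 1} = {0, 1, 2, 3}" using assms(1) by auto
    then show ?thesis by (simp add: poly_\<Psi>_sum)
  qed
  show ?thesis
  proof (cases "x \<le> 1 / 3")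
    case True
    have "(?p 1)\<^sup>2 < 4 * ?p 0 * (?p 2 + ?p 3 / 3)"
    proof -
      have "27 * (4 * ?p 0 * (?p 2 + ?p 3 / 3) - (?p 1)\<^sup>2)
          = 4 * ?p 0 * (3 * (9 * ?p 2) + 9 * ?p 3) - 3 * (3 * ?p 1)\<^sup>2"
        by (simp add: power2_eq_square algebra_simps)
      also have "\<dots> = 114997 + 254028 * y + 115956 * y\<^sup>2 + 19712 * y ^ 3 + 1152 * y ^ 4"
        unfolding p0 p1 p2 p3 by algebra
      also have "\<dots> > 0" using y by (intro add_pos_nonneg) auto
      finally show ?thesis by simp
    qed
    then have "?p 0 + ?p 1 * x + (?p 2 + ?p 3 / 3) * x\<^sup>2 > 0"
      using y by (intro quadratic_pos) (auto simp: p0)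
    moreover have "?p 3 * (1 / 3) * x\<^sup>2 \<le> ?p 3 * x * x\<^sup>2"
      using True \<open>?p 3 \<le> 0\<close> by (intro mult_right_mono mult_left_mono_neg) auto
    ultimately show ?thesis unfolding expand by (simp add: power2_eq_square power3_eq_cube algebra_simps)
  next
    case False
    have "?p 3 * 1 * x\<^sup>2 \<le> ?p 3 * x * x\<^sup>2"
      using assms \<open>?p 3 \<le> 0\<close> by (intro mult_right_mono mult_left_mono_neg) auto
    then have "poly \<Psi> x \<ge> ?p 0 + ?p 1 * x + (?p 2 + ?p 3) * x\<^sup>2"
      unfolding expand by (simp add: power2_eq_square power3_eq_cube algebra_simps)
    \<comment> \<open>Taylor expansion at \<open>1 / 3\<close>: the value there is positive, the
      slope and the leading coefficient are nonnegative.\<close>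
    moreover have "?p 0 + ?p 1 * x + (?p 2 + ?p 3) * x\<^sup>2 =
        (9 * ?p 0 + 3 * ?p 1 + (?p 2 + ?p 3)) / 9
        + (x - 1 / 3) * (?p 1 + (?p 2 + ?p 3) * (2 / 3) + (?p 2 + ?p 3) * (x - 1 / 3))"
      by (simp add: field_simps power2_eq_square)
    moreover have "9 * ?p 0 + 3 * ?p 1 + (?p 2 + ?p 3) > 0"
    proof -
      have "9 * (9 * ?p 0 + 3 * ?p 1 + (?p 2 + ?p 3)) = 249 + 846 * y + 276 * y\<^sup>2 + 24 * y ^ 3"
        using p0 p1 p2 p3 by algebra
      also have "\<dots> > 0" using y by (intro add_pos_nonneg) auto
      finally show ?thesis by simp
    qed
    moreover have q: "?p 2 + ?p 3 \<ge> 0"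
    proof -
      have "9 * (?p 2 + ?p 3) = 4920 + 2484 * y + 420 * y\<^sup>2 + 24 * y ^ 3" using p2 p3 by algebra
      also have "\<dots> \<ge> 0" using y by simp
      finally show ?thesis by simp
    qed
    moreover have "?p 1 + (?p 2 + ?p 3) * (2 / 3) \<ge> 0"
    proof -
      have "27 * (?p 1 + (?p 2 + ?p 3) * (2 / 3)) = 9 * (3 * ?p 1) + 2 * (9 * ?p 2 + 9 * ?p 3)"
        by simp
      also have "\<dots> = 3549 + 3006 * y + 696 * y\<^sup>2 + 48 * y ^ 3" unfolding p1 p2 p3 by algebra
      also have "\<dots> \<ge> 0" using y by simp
      finally show ?thesis by (subst (asm) zero_le_mult_iff) simp
    qed
    ultimately show ?thesis
      using False by (smt (verit, best) divide_pos_pos mult_nonneg_nonneg)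
  qed
qed

end

section \<open>From positivity of \<Psi> to the bound by \<open>H_fun\<close>\<close>

lemma S_setD: "(m, n) \<in> S_set \<Longrightarrow> 1 \<le> m \<and> m \<le> n \<and> (m = 1 \<and> 5 \<le> n \<or> 2 \<le> m \<and> 3 \<le> n)"
  by (auto simp: S_set_def)

text \<open>Keeps the denominator \<open>r^2 x - 1\<close> of \<open>H_fun\<close> positive above
  the threshold. It is enough that \<open>r\<close> is at least 10 and the product added to it at
  most 4.\<close>

lemma t_const_gt:
  assumes "1 \<le> m" "1 \<le> n"
  shows "1 / (r_const m n)\<^sup>2 < t_const m n"
proof -
  define p where "p = (1 + 1 / (2 * real m)) * (1 + 1 / (2 * real n))"
  have "1 + 1 / (2 * real k) \<le> 2" if "1 \<le> k" for k using that by (simp add: field_simps)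
  then have "p \<le> 2 * 2" unfolding p_def using assms by (intro mult_mono) auto
  moreover have "p > 0" unfolding p_def using assms by (intro mult_pos_pos add_pos_nonneg) auto
  moreover have r: "10 \<le> r_const m n"
    using mult_mono[of 3 "2 * real m + 1" 3 "2 * real n + 1"] assms by (simp add: r_const_def)
  moreover have "10 * r_const m n \<le> (r_const m n)\<^sup>2"
    unfolding power2_eq_square using r by (intro mult_right_mono) auto
  ultimately have "r_const m n + p < (r_const m n)\<^sup>2" "r_const m n + p > 0" by linarith+
  then show ?thesis unfolding t_const_def p_def[symmetric] by (intro divide_strict_left_mono mult_pos_pos) auto
qed

context moment_pair
begin

lemma poly_A: "poly A x = (\<Sum>i\<le>m. even_coeff m n i * x ^ i)"
  by (simp add: even_poly_def poly_sum poly_monom)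

lemma poly_B: "poly B x = (\<Sum>i\<le>m. even_coeff m n i / (2 * real i + 1) * x ^ i)"
  by (simp add: odd_poly_def poly_sum poly_monom)

lemma poly_B_pos: "0 \<le> x \<Longrightarrow> poly B x > 0"
  unfolding poly_B
  by (rule sum_pos2[of _ 0]) (auto intro!: mult_nonneg_nonneg divide_nonneg_nonneg even_coeff_nonneg)

lemma odd_coeff_le: "even_coeff m n i / (2 * real i + 1) \<le> even_coeff m n i"
proof -
  have "even_coeff m n i * 1 \<le> even_coeff m n i * (2 * real i + 1)"
    by (intro mult_left_mono even_coeff_nonneg) simp
  then show ?thesis by (simp add: divide_le_eq add_nonneg_pos)
qed

lemma poly_B_le_A: "0 \<le> x \<Longrightarrow> poly B x \<le> poly A x"
  unfolding poly_A poly_B by (intro sum_mono mult_right_mono odd_coeff_le) simp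

lemma poly_A_pos: "0 \<le> x \<Longrightarrow> poly A x > 0"
  using poly_B_pos poly_B_le_A by (rule less_le_trans)

lemma poly_B_less_A:
  assumes "1 \<le> m" "1 \<le> n" "0 < x"
  shows "poly B x < poly A x"
  unfolding poly_A poly_B
proof (rule sum_strict_mono_ex1)
  show "\<forall>i\<in>{..m}. even_coeff m n i / (2 * real i + 1) * x ^ i \<le> even_coeff m n i * x ^ i"
    using assms(3) by (intro ballI mult_right_mono odd_coeff_le) simp
  have "even_coeff m n 1 / (2 * real 1 + 1) * x ^ 1 < even_coeff m n 1 * x ^ 1"
    using even_coeff_pos[of 1 m n] assms by simp
  then show "\<exists>i\<in>{..m}. even_coeff m n i / (2 * real i + 1) * x ^ i < even_coeff m n i * x ^ i"
    using assms(1) by blast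
qed simp

text \<open>In the notation of the proof, \<open>H_fun\<close> is the larger root of
  \<open>d h^2 - 2 M y h - s (1 - x)\<close>, and \<Psi> is \<open>- A^2\<close> times this
  quadratic at \<open>h = B / A\<close>.\<close>

lemma ratio_less_H_fun:
  assumes "(m, n) \<in> S_set" "t_const m n < x" "x \<le> 1"
  shows "poly B x / poly A x < H_fun m n x"
proof -
  have mn: "1 \<le> m" "m \<le> n" using S_setD[OF assms(1)] by auto
  define r where "r = r_const m n"
  have r: "r = s + 1" by (simp add: r_def r_const_def s_def a_def b_def)
  have "r > 0" by (simp add: r s_def a_def b_def add_pos_pos)
  have "1 / r\<^sup>2 < x" using t_const_gt[of m n] mn assms(2) by (simp add: r_def)
  then have d: "r\<^sup>2 * x - 1 > 0" using \<open>r > 0\<close> by (simp add: field_simps)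
  have "x > 0" by (rule le_less_trans[OF _ \<open>1 / r\<^sup>2 < x\<close>]) simp
  have A: "poly A x > 0" using \<open>x > 0\<close> by (simp add: poly_A_pos)
  have "poly \<Psi> x > 0"
    using S_setD[OF assms(1)] \<Psi>_pos_ge_2[of x] \<Psi>_pos_1[of x] assms(3) \<open>x > 0\<close> by auto
  then have \<Psi>: "s * (1 - x) * (poly A x)\<^sup>2 + c * (r * x - 1) * (poly A x * poly B x)
      - (r\<^sup>2 * x - 1) * (poly B x)\<^sup>2 > 0"
    by (simp add: \<Psi>_def r power2_eq_square algebra_simps)
  define d where "d = r\<^sup>2 * x - 1"
  define y where "y = r * x - 1"
  define M where "M = real m + real n + 1"
  define D where "D = ((real n - real m) * y)\<^sup>2 + (2 * real m + 1) ^ 3 * (2 * real n + 1) ^ 3 * x"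
  have "d > 0" using d by (simp add: d_def)
  have c: "c = 2 * M" by (simp add: c_def a_def b_def M_def)
  \<comment> \<open>The radicand of \<open>H_fun\<close> is a quarter of the discriminant, because
    \<open>M^2 - (n - m)^2 = s\<close> and \<open>y^2 + (1 - x) d = s^2 x\<close>.\<close>
  have D: "D = M\<^sup>2 * y\<^sup>2 + s * (1 - x) * d"
    unfolding D_def M_def y_def d_def r s_def a_def b_def by algebra
  have "(d * poly B x - M * y * poly A x)\<^sup>2 = D * (poly A x)\<^sup>2
      - d * (s * (1 - x) * (poly A x)\<^sup>2 + c * y * (poly A x * poly B x) - d * (poly B x)\<^sup>2)"
    unfolding D c by algebra
  also have "\<dots> < D * (poly A x)\<^sup>2"
    using \<Psi> \<open>d > 0\<close> by (simp add: d_def y_def)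
  \<comment> \<open>Valid for either sign of the left side, so the signs of \<open>y\<close> and of
    the difference are irrelevant.\<close>
  finally have "d * poly B x - M * y * poly A x < sqrt (D * (poly A x)\<^sup>2)"
    by (rule real_less_rsqrt)
  also have "\<dots> = sqrt D * poly A x" using A by (simp add: real_sqrt_mult)
  finally have "d * poly B x < (M * y + sqrt D) * poly A x" by (simp add: algebra_simps)
  then have "poly B x / poly A x < (M * y + sqrt D) / d"
    using A \<open>d > 0\<close> by (simp add: field_simps)
  then show ?thesis by (simp add: H_fun_def Let_def r_def[symmetric] d_def y_def M_def D_def)
qed

end

section \<open>Coefficients of powers of a quadratic polynomial\<close>

lemma coeff_binomial_poly:
  fixes p r :: real
  shows "coeff ((monom r 2 + [:p:]) ^ N) d =
    (if even d then real (N choose (d div 2)) * r ^ (d div 2) * p ^ (N - d div 2) else 0)"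
proof -
  have "coeff ((monom r 2 + [:p:]) ^ N) d =
      (\<Sum>g\<le>N. if 2 * g = d then real (N choose g) * r ^ g * p ^ (N - g) else 0)"
    unfolding binomial_ring coeff_sum
    by (intro sum.cong refl)
      (simp add: monom_power poly_const_pow of_nat_poly mult.commute[of _ "[:_:]"] mult_ac)
  also have "\<dots> = (if even d then real (N choose (d div 2)) * r ^ (d div 2) * p ^ (N - d div 2) else 0)"
  proof (cases "even d \<and> d div 2 \<le> N")
    case True
    then have "(\<Sum>g\<le>N. if 2 * g = d then real (N choose g) * r ^ g * p ^ (N - g) else 0) =
        (\<Sum>g\<in>{d div 2}. real (N choose g) * r ^ g * p ^ (N - g))"
      by (intro sum.mono_neutral_cong_right) auto
    with True show ?thesis by simp
  next
    case False
    then have "(\<Sum>g\<le>N. if 2 * g = d then real (N choose g) * r ^ g * p ^ (N - g) else 0) = 0"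
      by (intro sum.neutral) auto
    with False show ?thesis by (auto simp: binomial_eq_0)
  qed
  finally show ?thesis .
qed

text \<open>Here \<open>k\<close> counts the factors contributing their linear term; the others
  contribute degree 0 or 2, so \<open>j - k\<close> must be even.\<close>

lemma coeff_trinomial_power:
  fixes p q r :: real
  shows "coeff ([:p, q, r:] ^ N) j =
    (\<Sum>k\<le>N. if k \<le> j \<and> even (j - k)
       then real (N choose k) * q ^ k *
            (real ((N - k) choose ((j - k) div 2)) * r ^ ((j - k) div 2) * p ^ (N - k - (j - k) div 2))
       else 0)"
proof -
  have split: "[:p, q, r:] = monom q 1 + (monom r 2 + [:p:])"
    by (simp add: monom_altdef numeral_2_eq_2)
  show ?thesis
    unfolding split binomial_ring[of "monom q 1"] coeff_sum
    by (intro sum.cong refl)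
      (simp add: monom_power of_nat_poly coeff_monom_mult coeff_binomial_poly mult.assoc)
qed

lemma even_coeff_fact:
  assumes "i \<le> m" "i \<le> n"
  shows "even_coeff m n i = fact m * fact n * 4 ^ i / (fact (m - i) * fact (n - i) * fact (2 * i))"
  using assms by (simp add: even_coeff_def binomial_fact power2_eq_square)

text \<open>In degree \<open>2 n\<close> the number of linear factors is even, say
  \<open>2 i\<close>, leaving \<open>n - i\<close> quadratic and \<open>m - i\<close> constant ones.
  The multinomial coefficient times \<open>4 ^ i\<close> is \<open>even_coeff m n i\<close> up to a
  factor independent of \<open>i\<close>.\<close>

lemma coeff_trinomial_power_even:
  fixes p q r :: real
  assumes "m \<le> n"
  shows "coeff ([:p, 2 * q, r:] ^ (m + n)) (2 * n) =
    fact (m + n) / (fact m * fact n) *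
      (\<Sum>i\<le>m. even_coeff m n i * p ^ (m - i) * r ^ (n - i) * q ^ (2 * i))"
proof -
  let ?f = "\<lambda>k. if k \<le> 2 * n \<and> even (2 * n - k)
       then real ((m + n) choose k) * (2 * q) ^ k *
            (real ((m + n - k) choose ((2 * n - k) div 2)) * r ^ ((2 * n - k) div 2)
              * p ^ (m + n - k - (2 * n - k) div 2))
       else 0"
  have "(\<Sum>k\<le>m + n. ?f k) = (\<Sum>k\<in>(\<lambda>i. 2 * i) ` {..m}. ?f k)"
  proof (rule sum.mono_neutral_right)
    show "\<forall>k\<in>{..m + n} - (\<lambda>i. 2 * i) ` {..m}. ?f k = 0"
    proof
      fix k assume k: "k \<in> {..m + n} - (\<lambda>i. 2 * i) ` {..m}"
      show "?f k = 0"
      proof (cases "k \<le> 2 * n \<and> even (2 * n - k)")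
        case True
        then obtain i where i: "k = 2 * i" by (auto elim!: evenE)
        with k have "m < i" by auto
        \<comment> \<open>Only \<open>m + n - 2 i < n - i\<close> factors are left, too few to
          supply \<open>n - i\<close> quadratic ones.\<close>
        then have "(m + n - k) choose ((2 * n - k) div 2) = 0"
          using k True by (intro binomial_eq_0) (auto simp: i)
        then show ?thesis by simp
      qed auto
    qed
  qed (use assms in auto)
  also have "\<dots> = (\<Sum>i\<le>m. ?f (2 * i))"
    by (rule sum.reindex[of "\<lambda>i. 2 * i" "{..m}" ?f, unfolded comp_def]) (simp add: inj_on_def)
  also have "\<dots> = (\<Sum>i\<le>m. fact (m + n) / (fact m * fact n) *
      (even_coeff m n i * p ^ (m - i) * r ^ (n - i) * q ^ (2 * i)))"
  proof (rule sum.cong)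
    fix i assume "i \<in> {..m}"
    then have i: "i \<le> m" "i \<le> n" using assms by auto
    then have e: "(2 * n - 2 * i) div 2 = n - i" "m + n - 2 * i - (n - i) = m - i"
      "m + n - 2 * i - (m - i) = n - i" by auto
    have ch: "real ((m + n) choose (2 * i)) * real ((m + n - 2 * i) choose (n - i))
        = fact (m + n) / (fact (2 * i) * fact (m - i) * fact (n - i))"
      using i by (simp add: binomial_fact e)
    have pw: "(2 * q) ^ (2 * i) = 4 ^ i * q ^ (2 * i)"
      by (simp add: power_mult power_mult_distrib)
    have "?f (2 * i) = (real ((m + n) choose (2 * i)) * real ((m + n - 2 * i) choose (n - i)))
        * (2 * q) ^ (2 * i) * r ^ (n - i) * p ^ (m - i)"
      using i unfolding e by (simp add: mult_ac)
    also have "\<dots> = fact (m + n) / (fact m * fact n) *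
        (even_coeff m n i * p ^ (m - i) * r ^ (n - i) * q ^ (2 * i))"
      unfolding ch pw even_coeff_fact[OF i] by (simp add: field_simps)
    finally show "?f (2 * i) = fact (m + n) / (fact m * fact n) *
        (even_coeff m n i * p ^ (m - i) * r ^ (n - i) * q ^ (2 * i))" .
  qed simp
  finally show ?thesis unfolding coeff_trinomial_power sum_distrib_left .
qed

text \<open>Now the number of linear factors is \<open>2 i + 1\<close>. The extra factor of
  \<open>(2 i + 1)!\<close> over \<open>(2 i)!\<close> produces the denominators of
  \<open>odd_poly\<close>.\<close>

lemma coeff_trinomial_power_odd:
  fixes p q r :: real
  assumes "m \<le> n"
  shows "coeff ([:p, 2 * q, r:] ^ (m + n + 1)) (2 * n + 1) =
    fact (m + n + 1) / (fact m * fact n) * (2 * q *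
      (\<Sum>i\<le>m. even_coeff m n i / (2 * real i + 1) * p ^ (m - i) * r ^ (n - i) * q ^ (2 * i)))"
proof -
  let ?f = "\<lambda>k. if k \<le> 2 * n + 1 \<and> even (2 * n + 1 - k)
       then real ((m + n + 1) choose k) * (2 * q) ^ k *
            (real ((m + n + 1 - k) choose ((2 * n + 1 - k) div 2)) * r ^ ((2 * n + 1 - k) div 2)
              * p ^ (m + n + 1 - k - (2 * n + 1 - k) div 2))
       else 0"
  have "(\<Sum>k\<le>m + n + 1. ?f k) = (\<Sum>k\<in>(\<lambda>i. 2 * i + 1) ` {..m}. ?f k)"
  proof (rule sum.mono_neutral_right)
    show "\<forall>k\<in>{..m + n + 1} - (\<lambda>i. 2 * i + 1) ` {..m}. ?f k = 0"
    proof
      fix k assume k: "k \<in> {..m + n + 1} - (\<lambda>i. 2 * i + 1) ` {..m}"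
      show "?f k = 0"
      proof (cases "k \<le> 2 * n + 1 \<and> even (2 * n + 1 - k)")
        case True
        then have "odd k" by auto
        then obtain i where i: "k = 2 * i + 1" by (auto elim!: oddE)
        with k have "m < i" by auto
        then have "(m + n + 1 - k) choose ((2 * n + 1 - k) div 2) = 0"
          using k True by (intro binomial_eq_0) (auto simp: i)
        then show ?thesis by simp
      qed auto
    qed
  qed (use assms in auto)
  also have "\<dots> = (\<Sum>i\<le>m. ?f (2 * i + 1))"
    by (rule sum.reindex[of "\<lambda>i. 2 * i + 1" "{..m}" ?f, unfolded comp_def]) (simp add: inj_on_def)
  also have "\<dots> = (\<Sum>i\<le>m. fact (m + n + 1) / (fact m * fact n) * (2 * q *
      (even_coeff m n i / (2 * real i + 1) * p ^ (m - i) * r ^ (n - i) * q ^ (2 * i))))"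
  proof (rule sum.cong)
    fix i assume "i \<in> {..m}"
    then have i: "i \<le> m" "i \<le> n" using assms by auto
    then have e: "(2 * n + 1 - (2 * i + 1)) div 2 = n - i" "m + n + 1 - (2 * i + 1) - (n - i) = m - i"
      "m + n + 1 - (2 * i + 1) - (m - i) = n - i" "m + n - 2 * i - (n - i) = m - i"
      "m + n - 2 * i - (m - i) = n - i" "(2 * n - 2 * i) div 2 = n - i" by auto
    have "real ((m + n + 1) choose (2 * i + 1)) * real ((m + n + 1 - (2 * i + 1)) choose (n - i))
        = fact (m + n + 1) / (fact (2 * i + 1) * fact (m - i) * fact (n - i))"
    proof -
      have "real ((m + n + 1) choose (2 * i + 1))
          = fact (m + n + 1) / (fact (2 * i + 1) * fact (m + n + 1 - (2 * i + 1)))"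
        using i by (intro binomial_fact) simp
      moreover have "real ((m + n + 1 - (2 * i + 1)) choose (n - i))
          = fact (m + n + 1 - (2 * i + 1)) / (fact (n - i) * fact (m - i))"
      proof -
        have "n - i \<le> m + n + 1 - (2 * i + 1)" using i by arith
        from binomial_fact[OF this] show ?thesis unfolding e .
      qed
      ultimately show ?thesis by (simp only:) (simp add: mult_ac del: fact_Suc)
    qed
    also have "fact (2 * i + 1) = (2 * real i + 1) * fact (2 * i)"
      by (simp add: algebra_simps)
    finally have ch: "real ((m + n + 1) choose (2 * i + 1)) * real ((m + n + 1 - (2 * i + 1)) choose (n - i))
        = fact (m + n + 1) / ((2 * real i + 1) * fact (2 * i) * fact (m - i) * fact (n - i))" .
    have pw: "(2 * q) ^ (2 * i + 1) = 2 * q * (4 ^ i * q ^ (2 * i))"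
      by (simp add: power_mult power_mult_distrib)
    have "?f (2 * i + 1) = (real ((m + n + 1) choose (2 * i + 1)) *
        real ((m + n + 1 - (2 * i + 1)) choose (n - i))) * (2 * q) ^ (2 * i + 1) * r ^ (n - i) * p ^ (m - i)"
      using i unfolding e by (simp add: e mult_ac del: power_Suc binomial_Suc_Suc)
    also have "\<dots> = fact (m + n + 1) / (fact m * fact n) *
        (2 * q * (even_coeff m n i / (2 * real i + 1) * p ^ (m - i) * r ^ (n - i) * q ^ (2 * i)))"
      unfolding ch pw even_coeff_fact[OF i] by (simp add: field_simps del: fact_Suc of_nat_Suc)
    finally show "?f (2 * i + 1) = fact (m + n + 1) / (fact m * fact n) *
        (2 * q * (even_coeff m n i / (2 * real i + 1) * p ^ (m - i) * r ^ (n - i) * q ^ (2 * i)))" .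
  qed simp
  finally show ?thesis unfolding coeff_trinomial_power sum_distrib_left .
qed

section \<open>Gaussian moments and independence\<close>

text \<open>One formula for the density and the point mass, so moments and characteristic functions
  need no case split on \<open>\<sigma> = 0\<close>.\<close>

lemma gaussian_law_eq_distr:
  assumes "0 \<le> \<sigma>"
  shows "gaussian_law \<mu> \<sigma> = distr std_normal_distribution borel (\<lambda>x. \<mu> + \<sigma> * x)"
proof (cases "\<sigma> = 0")
  case True
  interpret prob_space std_normal_distribution by (rule prob_space_normal_density) simp
  show ?thesis using True by (simp add: gaussian_law_def)
next
  case False
  interpret prob_space std_normal_distribution by (rule prob_space_normal_density) simp
  have "distributed std_normal_distribution lborel (\<lambda>x. x) std_normal_density"
    by (auto simp: distributed_def distr_id2)
  from normal_density_affine[OF this, of \<sigma> \<mu>] False assms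
  have "distributed std_normal_distribution lborel (\<lambda>x. \<mu> + \<sigma> * x) (normal_density \<mu> \<sigma>)"
    by simp
  then have "distr std_normal_distribution lborel (\<lambda>x. \<mu> + \<sigma> * x) = density lborel (normal_density \<mu> \<sigma>)"
    by (simp add: distributed_def)
  moreover have "distr std_normal_distribution lborel (\<lambda>x. \<mu> + \<sigma> * x)
      = distr std_normal_distribution borel (\<lambda>x. \<mu> + \<sigma> * x)"
    by (intro distr_cong) auto
  ultimately show ?thesis using False by (simp add: gaussian_law_def)
qed

lemma integrable_affine_power_std_normal:
  "integrable std_normal_distribution (\<lambda>x. (\<mu> + \<sigma> * x) ^ k)"
proof -
  have "integrable std_normal_distribution (\<lambda>x. of_nat (k choose i) * \<mu> ^ i * \<sigma> ^ (k - i) * x ^ (k - i))" for i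
    by (intro integrable_mult_right integrable_std_normal_distribution_moment)
  then show ?thesis
    by (simp add: binomial_ring power_mult_distrib mult.assoc)
qed

lemma (in prob_space) gaussian_integrable_power:
  assumes [measurable]: "random_variable borel Z"
    and Z: "distr M borel Z = gaussian_law \<mu> \<sigma>" "0 \<le> \<sigma>"
  shows "integrable M (\<lambda>\<omega>. Z \<omega> ^ k)"
proof -
  have "integrable (distr M borel Z) (\<lambda>x. x ^ k)"
    unfolding Z(1) gaussian_law_eq_distr[OF Z(2)]
    by (simp add: integrable_distr_eq integrable_affine_power_std_normal)
  then show ?thesis by (simp add: integrable_distr_eq)
qed

lemma (in prob_space) gaussian_expectation:
  assumes [measurable]: "random_variable borel Z"
    and Z: "distr M borel Z = gaussian_law \<mu> \<sigma>" "0 \<le> \<sigma>"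
  shows "expectation Z = \<mu>"
proof -
  interpret N: prob_space std_normal_distribution by (rule prob_space_normal_density) simp
  have "expectation Z = (\<integral>x. x \<partial>distr M borel Z)" by (simp add: integral_distr)
  also have "\<dots> = (\<integral>x. \<mu> + \<sigma> * x \<partial>std_normal_distribution)"
    unfolding Z(1) gaussian_law_eq_distr[OF Z(2)] by (simp add: integral_distr)
  also have "\<dots> = \<mu> + \<sigma> * (\<integral>x. x \<partial>std_normal_distribution)"
    using integrable_std_normal_distribution_moment[of 1] N.prob_space by simp
  also have "(\<integral>x. x \<partial>std_normal_distribution) = 0"
    using integral_std_normal_distribution_moment_odd[of 1] by simp
  finally show ?thesis by simp
qed

lemma (in prob_space) centered_gaussian_moment:
  assumes [measurable]: "random_variable borel Z"
    and Z: "distr M borel Z = gaussian_law 0 \<sigma>" "0 \<le> \<sigma>"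
  shows "expectation (\<lambda>\<omega>. Z \<omega> ^ (2 * k)) = fact (2 * k) / (2 ^ k * fact k) * \<sigma> ^ (2 * k)"
proof -
  have "expectation (\<lambda>\<omega>. Z \<omega> ^ (2 * k)) = (\<integral>x. x ^ (2 * k) \<partial>distr M borel Z)"
    by (simp add: integral_distr)
  also have "\<dots> = (\<integral>x. \<sigma> ^ (2 * k) * x ^ (2 * k) \<partial>std_normal_distribution)"
    unfolding Z(1) gaussian_law_eq_distr[OF Z(2)] by (simp add: integral_distr power_mult_distrib)
  finally show ?thesis by (simp add: std_normal_distribution_even_moments)
qed

lemma (in prob_space) centered_gaussian_moment_variance:
  assumes "random_variable borel Z"
    and "distr M borel Z = gaussian_law 0 \<sigma>" "0 \<le> \<sigma>"
  shows "expectation (\<lambda>\<omega>. Z \<omega> ^ (2 * k)) =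
    fact (2 * k) / (2 ^ k * fact k) * expectation (\<lambda>\<omega>. (Z \<omega>)\<^sup>2) ^ k"
  using centered_gaussian_moment[OF assms, of k] centered_gaussian_moment[OF assms, of 1]
  by (simp add: power_mult)

lemma (in prob_space) centered_gaussian_char:
  assumes [measurable]: "random_variable borel Z"
    and Z: "distr M borel Z = gaussian_law 0 \<sigma>" "0 \<le> \<sigma>"
  shows "(\<integral>\<omega>. iexp (Z \<omega>) \<partial>M) = exp (- expectation (\<lambda>\<omega>. (Z \<omega>)\<^sup>2) / 2)"
proof -
  have "(\<integral>\<omega>. iexp (Z \<omega>) \<partial>M) = (\<integral>x. iexp x \<partial>distr M borel Z)"
    by (simp add: integral_distr)
  also have "\<dots> = char std_normal_distribution \<sigma>"
    unfolding Z(1) gaussian_law_eq_distr[OF Z(2)] by (simp add: integral_distr char_def)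
  also have "\<dots> = exp (- expectation (\<lambda>\<omega>. (Z \<omega>)\<^sup>2) / 2)"
    using centered_gaussian_moment[OF assms, of 1] by (simp add: char_std_normal_distribution)
  finally show ?thesis .
qed

section \<open>Independence from factorising characteristic functions\<close>

lemma iexp_add: "iexp (x + y) = iexp x * iexp y"
  by (simp add: exp_add distrib_left)

lemma of_real_cos_iexp: "complex_of_real (cos x) = (iexp x + iexp (- x)) / 2"
  by (simp add: cos_of_real[symmetric] cos_exp_eq del: cos_of_real)

text \<open>Rewrites a weighted exponential as exponentials of linear combinations. The summand 1
  keeps the weight nonnegative; the phase \<theta> covers sine as well as cosine.\<close>

lemma one_plus_cos_iexp:
  "complex_of_real (1 + cos (x + \<theta>)) * iexp y =
     iexp y + (iexp \<theta> / 2 * iexp (x + y) + iexp (- \<theta>) / 2 * iexp (- x + y))"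
proof -
  have "- (x + \<theta>) = - x + - \<theta>" by simp
  then have "complex_of_real (cos (x + \<theta>)) = (iexp x * iexp \<theta> + iexp (- x) * iexp (- \<theta>)) / 2"
    by (metis of_real_cos_iexp iexp_add)
  then have "complex_of_real (1 + cos (x + \<theta>)) * iexp y =
      (1 + (iexp x * iexp \<theta> + iexp (- x) * iexp (- \<theta>)) / 2) * iexp y"
    by (simp only: of_real_add[of 1] of_real_1)
  moreover have "(1 + (a * b + c * d) / 2) * e = e + (b / 2 * (a * e) + d / 2 * (c * e))"
    for a b c d e :: complex by (simp add: field_simps)
  ultimately show ?thesis by (simp only: iexp_add[of x y] iexp_add[of "- x" y])
qed

text \<open>After normalisation \<open>f\<close> is the density of a probability measure under which
  \<open>Y\<close> has the same characteristic function as under \<open>M\<close>; Levy's uniqueness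
  theorem then identifies the two laws of \<open>Y\<close>. If \<open>f\<close> has expectation 0,
  it vanishes almost everywhere.\<close>

lemma (in prob_space) weighted_distribution_unique:
  assumes [measurable]: "random_variable borel Y" "f \<in> borel_measurable M" "A \<in> sets borel"
    and f: "\<And>\<omega>. \<omega> \<in> space M \<Longrightarrow> 0 \<le> f \<omega>" "\<And>\<omega>. \<omega> \<in> space M \<Longrightarrow> f \<omega> \<le> K"
    and char: "\<And>q. (\<integral>\<omega>. complex_of_real (f \<omega>) * iexp (q * Y \<omega>) \<partial>M)
                 = complex_of_real (expectation f) * (\<integral>\<omega>. iexp (q * Y \<omega>) \<partial>M)"
  shows "expectation (\<lambda>\<omega>. f \<omega> * indicat_real A (Y \<omega>)) = expectation f * prob (Y -` A \<inter> space M)"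
proof -
  have int: "integrable M f"
    by (rule integrable_const_bound[of _ K]) (use f in auto)
  show ?thesis
  proof (cases "expectation f = 0")
    case True
    then have "AE \<omega> in M. f \<omega> = 0"
      using integral_nonneg_eq_0_iff_AE[OF int] f by auto
    then have "expectation (\<lambda>\<omega>. f \<omega> * indicat_real A (Y \<omega>)) = expectation (\<lambda>\<omega>. 0)"
      by (intro integral_cong_AE) auto
    with True show ?thesis by simp
  next
    case False
    define e where "e = expectation f"
    have "e \<ge> 0" unfolding e_def by (rule integral_nonneg_AE) (use f in auto)
    with False have e: "e > 0" by (simp add: e_def)
    define g where "g = (\<lambda>\<omega>. f \<omega> / e)"
    have [measurable]: "g \<in> borel_measurable M" by (simp add: g_def)
    have g: "AE \<omega> in M. 0 \<le> g \<omega>" using f e by (auto simp: g_def)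
    define N where "N = density M (\<lambda>\<omega>. ennreal (g \<omega>))"
    have [simp]: "space N = space M" "sets N = sets M" by (simp_all add: N_def)
    have "integrable M g" using int by (simp add: g_def)
    then have "(\<integral>\<^sup>+\<omega>. ennreal (g \<omega>) \<partial>M) = ennreal (expectation g)"
      using g by (intro nn_integral_eq_integral) auto
    also have "expectation g = 1" using e by (simp add: g_def e_def)
    finally interpret N: prob_space N
      by (intro prob_spaceI) (simp add: N_def emeasure_density cong: nn_integral_cong)
    have [measurable]: "Y \<in> borel_measurable N" by (simp add: N_def)
    have rd: "real_distribution (distr N borel Y)" "real_distribution (distr M borel Y)"
      by (auto intro!: N.real_distribution_distr real_distribution_distr)
    have "char (distr N borel Y) = char (distr M borel Y)"
    proof
      fix q
      have "char (distr N borel Y) q = (\<integral>\<omega>. iexp (q * Y \<omega>) \<partial>N)"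
        by (simp add: char_def integral_distr)
      also have "\<dots> = (\<integral>\<omega>. g \<omega> *\<^sub>R iexp (q * Y \<omega>) \<partial>M)"
        unfolding N_def using g by (intro integral_density) auto
      also have "\<dots> = (\<integral>\<omega>. (complex_of_real (f \<omega>) * iexp (q * Y \<omega>)) / complex_of_real e \<partial>M)"
        by (intro Bochner_Integration.integral_cong) (auto simp: g_def scaleR_conv_of_real)
      also have "\<dots> = (\<integral>\<omega>. complex_of_real (f \<omega>) * iexp (q * Y \<omega>) \<partial>M) / complex_of_real e"
        by (rule integral_divide_zero)
      also have "\<dots> = (\<integral>\<omega>. iexp (q * Y \<omega>) \<partial>M)"
        unfolding char e_def[symmetric] using e by simp
      also have "\<dots> = char (distr M borel Y) q"
        by (simp add: char_def integral_distr)
      finally show "char (distr N borel Y) q = char (distr M borel Y) q" .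
    qed
    with rd have eq: "distr N borel Y = distr M borel Y" by (rule Levy_uniqueness)
    have "prob (Y -` A \<inter> space M) = measure (distr M borel Y) A" by (simp add: measure_distr)
    also have "\<dots> = measure N (Y -` A \<inter> space M)" unfolding eq[symmetric] by (simp add: measure_distr)
    also have "\<dots> = (\<integral>\<omega>. indicator (Y -` A \<inter> space M) \<omega> \<partial>N)" by simp
    also have "\<dots> = (\<integral>\<omega>. g \<omega> *\<^sub>R indicator (Y -` A \<inter> space M) \<omega> \<partial>M)"
      unfolding N_def using g by (intro integral_density) auto
    also have "\<dots> = (\<integral>\<omega>. f \<omega> * indicat_real A (Y \<omega>) / e \<partial>M)"
      by (intro Bochner_Integration.integral_cong) (auto simp: g_def indicator_def)
    also have "\<dots> = expectation (\<lambda>\<omega>. f \<omega> * indicat_real A (Y \<omega>)) / e" by simp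
    finally show ?thesis using e by (simp add: e_def field_simps)
  qed
qed

text \<open>Weighting first by \<open>1 + cos (p X + \<theta>)\<close> and then by the indicator of \<open>Y \<in> A\<close> reduces the claim to the
  one-dimensional uniqueness theorem, so no characteristic functions of measures on the plane occur.\<close>

lemma (in prob_space) indep_var_of_char:
  assumes [measurable]: "random_variable borel X" "random_variable borel Y"
    and char: "\<And>p q. (\<integral>\<omega>. iexp (p * X \<omega> + q * Y \<omega>) \<partial>M) =
       (\<integral>\<omega>. iexp (p * X \<omega>) \<partial>M) * (\<integral>\<omega>. iexp (q * Y \<omega>) \<partial>M)"
  shows "indep_var borel X borel Y"
proof -
  have int: "integrable M (\<lambda>\<omega>. iexp (h \<omega>))" if "h \<in> borel_measurable M" for h :: "'a \<Rightarrow> real"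
    using that by (intro integrable_const_bound[of _ 1]) auto
  have weighted: "expectation (\<lambda>\<omega>. cos (p * X \<omega> + \<theta>) * indicat_real A (Y \<omega>))
      = expectation (\<lambda>\<omega>. cos (p * X \<omega> + \<theta>)) * prob (Y -` A \<inter> space M)"
    if [measurable]: "A \<in> sets borel" for p \<theta> A
  proof -
    have icos: "integrable M (\<lambda>\<omega>. cos (p * X \<omega> + \<theta>))"
      by (intro integrable_const_bound[of _ 1]) auto
    have expand: "complex_of_real (1 + cos (p * X \<omega> + \<theta>)) * iexp (q * Y \<omega>) =
        iexp (q * Y \<omega>) + (iexp \<theta> / 2 * iexp (p * X \<omega> + q * Y \<omega>)
          + iexp (- \<theta>) / 2 * iexp (- p * X \<omega> + q * Y \<omega>))" for q \<omega>
      using one_plus_cos_iexp[of "p * X \<omega>" \<theta> "q * Y \<omega>"] by (simp only: minus_mult_left)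
    have "(\<integral>\<omega>. complex_of_real (1 + cos (p * X \<omega> + \<theta>)) * iexp (q * Y \<omega>) \<partial>M) =
        (1 + (iexp \<theta> / 2 * (\<integral>\<omega>. iexp (p * X \<omega>) \<partial>M) + iexp (- \<theta>) / 2 * (\<integral>\<omega>. iexp (- p * X \<omega>) \<partial>M)))
         * (\<integral>\<omega>. iexp (q * Y \<omega>) \<partial>M)" for q
    proof -
      have i: "integrable M (\<lambda>\<omega>. c * iexp (h \<omega>))" if "h \<in> borel_measurable M" for c h
        using that by (intro integrable_mult_right int)
      have m: "(\<lambda>\<omega>. p * X \<omega> + q * Y \<omega>) \<in> borel_measurable M" for p by simp
      have "(\<integral>\<omega>. complex_of_real (1 + cos (p * X \<omega> + \<theta>)) * iexp (q * Y \<omega>) \<partial>M) =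
          (\<integral>\<omega>. iexp (q * Y \<omega>) \<partial>M) + (\<integral>\<omega>. iexp \<theta> / 2 * iexp (p * X \<omega> + q * Y \<omega>)
            + iexp (- \<theta>) / 2 * iexp (- p * X \<omega> + q * Y \<omega>) \<partial>M)"
        unfolding expand
        by (rule Bochner_Integration.integral_add) (intro Bochner_Integration.integrable_add i int m; simp)+
      also have "(\<integral>\<omega>. iexp \<theta> / 2 * iexp (p * X \<omega> + q * Y \<omega>)
            + iexp (- \<theta>) / 2 * iexp (- p * X \<omega> + q * Y \<omega>) \<partial>M) =
          iexp \<theta> / 2 * (\<integral>\<omega>. iexp (p * X \<omega> + q * Y \<omega>) \<partial>M)
            + iexp (- \<theta>) / 2 * (\<integral>\<omega>. iexp (- p * X \<omega> + q * Y \<omega>) \<partial>M)"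
        by (subst Bochner_Integration.integral_add) (rule i m integral_mult_right_zero arg_cong2[where f = "(+)"])+
      finally show ?thesis unfolding char by (simp only: distrib_right mult_1_left mult.assoc)
    qed
    note w = this
    \<comment> \<open>The case \<open>q = 0\<close> of the formula just obtained identifies its
      constant factor.\<close>
    have "1 + (iexp \<theta> / 2 * (\<integral>\<omega>. iexp (p * X \<omega>) \<partial>M) + iexp (- \<theta>) / 2 * (\<integral>\<omega>. iexp (- p * X \<omega>) \<partial>M))
        = complex_of_real (expectation (\<lambda>\<omega>. 1 + cos (p * X \<omega> + \<theta>)))"
    proof -
      have "(\<integral>\<omega>. complex_of_real (1 + cos (p * X \<omega> + \<theta>)) * iexp (0 * Y \<omega>) \<partial>M)
          = complex_of_real (expectation (\<lambda>\<omega>. 1 + cos (p * X \<omega> + \<theta>)))"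
        by (simp only: mult_zero_left of_real_0 mult_zero_right exp_zero mult_1_right integral_complex_of_real)
      moreover have "(\<integral>\<omega>. iexp (0 * Y \<omega>) \<partial>M) = 1" using prob_space by simp
      ultimately show ?thesis using w[of 0] by (simp only: mult_1_right)
    qed
    note w = w[unfolded this]
    have "expectation (\<lambda>\<omega>. (1 + cos (p * X \<omega> + \<theta>)) * indicat_real A (Y \<omega>))
        = expectation (\<lambda>\<omega>. 1 + cos (p * X \<omega> + \<theta>)) * prob (Y -` A \<inter> space M)"
    proof (rule weighted_distribution_unique[where K = 2])
      fix \<omega> show "0 \<le> 1 + cos (p * X \<omega> + \<theta>)" using cos_ge_minus_one[of "p * X \<omega> + \<theta>"] by linarith
    qed (use w in auto)
    moreover have "expectation (\<lambda>\<omega>. (1 + cos (p * X \<omega> + \<theta>)) * indicat_real A (Y \<omega>))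
        = prob (Y -` A \<inter> space M) + expectation (\<lambda>\<omega>. cos (p * X \<omega> + \<theta>) * indicat_real A (Y \<omega>))"
    proof -
      have "expectation (\<lambda>\<omega>. (1 + cos (p * X \<omega> + \<theta>)) * indicat_real A (Y \<omega>))
          = expectation (\<lambda>\<omega>. indicator (Y -` A \<inter> space M) \<omega> + cos (p * X \<omega> + \<theta>) * indicat_real A (Y \<omega>))"
        by (intro Bochner_Integration.integral_cong) (auto simp: indicator_def)
      also have "\<dots> = expectation (indicat_real (Y -` A \<inter> space M))
          + expectation (\<lambda>\<omega>. cos (p * X \<omega> + \<theta>) * indicat_real A (Y \<omega>))"
        by (intro Bochner_Integration.integral_add integrable_const_bound[of _ 1])
          (auto simp: indicator_def)
      finally show ?thesis by simp
    qed
    ultimately show ?thesis using icos prob_space by (simp add: algebra_simps)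
  qed
  have "prob ((X -` B \<inter> space M) \<inter> (Y -` A \<inter> space M)) = prob (X -` B \<inter> space M) * prob (Y -` A \<inter> space M)"
    if [measurable]: "A \<in> sets borel" "B \<in> sets borel" for A B
  proof -
    have ind: "expectation (\<lambda>\<omega>. indicat_real A (Y \<omega>)) = prob (Y -` A \<inter> space M)"
    proof -
      have "expectation (\<lambda>\<omega>. indicat_real A (Y \<omega>)) = expectation (indicat_real (Y -` A \<inter> space M))"
        by (intro Bochner_Integration.integral_cong) (auto simp: indicator_def)
      then show ?thesis by simp
    qed
    have "(\<integral>\<omega>. complex_of_real (indicat_real A (Y \<omega>)) * iexp (p * X \<omega>) \<partial>M)
        = complex_of_real (expectation (\<lambda>\<omega>. indicat_real A (Y \<omega>))) * (\<integral>\<omega>. iexp (p * X \<omega>) \<partial>M)" for p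
    proof (rule complex_eqI)
      have cs: "integrable M (\<lambda>\<omega>. complex_of_real (indicat_real A (Y \<omega>)) * iexp (p * X \<omega>))"
        by (intro integrable_const_bound[of _ 1]) (auto simp: norm_mult indicator_def)
      have ie: "integrable M (\<lambda>\<omega>. iexp (p * X \<omega>))" by (rule int) simp
      have c: "expectation (\<lambda>\<omega>. indicat_real A (Y \<omega>) * cos (p * X \<omega>))
          = prob (Y -` A \<inter> space M) * expectation (\<lambda>\<omega>. cos (p * X \<omega>))"
        using weighted[OF that(1), of p 0] by (simp add: mult.commute)
      have s: "expectation (\<lambda>\<omega>. indicat_real A (Y \<omega>) * sin (p * X \<omega>))
          = prob (Y -` A \<inter> space M) * expectation (\<lambda>\<omega>. sin (p * X \<omega>))"
      proof -
        \<comment> \<open>The phase \<open>- (pi / 2)\<close> supplies the imaginary part.\<close>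
        have "cos (x + - (pi / 2)) = sin x" for x :: real by (simp add: cos_diff)
        then show ?thesis
          using weighted[OF that(1), of p "- (pi / 2)"] by (simp only: mult.commute)
      qed
      show "Re (\<integral>\<omega>. complex_of_real (indicat_real A (Y \<omega>)) * iexp (p * X \<omega>) \<partial>M)
        = Re (complex_of_real (expectation (\<lambda>\<omega>. indicat_real A (Y \<omega>))) * (\<integral>\<omega>. iexp (p * X \<omega>) \<partial>M))"
        using cs ie c by (simp add: ind integral_Re[symmetric] Re_exp)
      show "Im (\<integral>\<omega>. complex_of_real (indicat_real A (Y \<omega>)) * iexp (p * X \<omega>) \<partial>M)
        = Im (complex_of_real (expectation (\<lambda>\<omega>. indicat_real A (Y \<omega>))) * (\<integral>\<omega>. iexp (p * X \<omega>) \<partial>M))"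
        using cs ie s by (simp add: ind integral_Im[symmetric] Im_exp)
    qed
    \<comment> \<open>Second use of the uniqueness lemma with exchanged roles: the indicator of
      \<open>Y \<in> A\<close> is the weight and \<open>X\<close> the variable.\<close>
    then have "expectation (\<lambda>\<omega>. indicat_real A (Y \<omega>) * indicat_real B (X \<omega>))
        = expectation (\<lambda>\<omega>. indicat_real A (Y \<omega>)) * prob (X -` B \<inter> space M)"
      by (intro weighted_distribution_unique[where K = 1]) (auto simp: indicator_def)
    moreover have "expectation (\<lambda>\<omega>. indicat_real A (Y \<omega>) * indicat_real B (X \<omega>))
        = expectation (indicat_real ((X -` B \<inter> space M) \<inter> (Y -` A \<inter> space M)))"
      by (intro Bochner_Integration.integral_cong) (auto simp: indicator_def)
    ultimately show ?thesis by (simp add: ind mult.commute)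
  qed
  moreover have "Int_stable {Z -` A \<inter> space M |A. A \<in> sets borel}" for Z :: "'a \<Rightarrow> real"
  proof (safe intro!: Int_stableI)
    fix A B :: "real set" assume "A \<in> sets borel" "B \<in> sets borel"
    then show "\<exists>C. (Z -` A \<inter> space M) \<inter> (Z -` B \<inter> space M) = Z -` C \<inter> space M \<and> C \<in> sets borel"
      by (intro exI[of _ "A \<inter> B"]) auto
  qed
  ultimately show ?thesis
    unfolding indep_var_eq
    by (intro conjI indep_set_sigma_sets assms(1,2)) (auto intro!: indep_setI)
qed

section \<open>Mixed moments of a centered Gaussian pair\<close>

locale centered_gaussian_pair = prob_space M for M :: "'w measure" +
  fixes X Y :: "'w \<Rightarrow> real"
  assumes gaussian: "centered_gaussian_vector M (\<lambda>\<omega>. (X \<omega>, Y \<omega>))"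
begin

definition V1 :: real where "V1 = expectation (\<lambda>\<omega>. (X \<omega>)\<^sup>2)"
definition V2 :: real where "V2 = expectation (\<lambda>\<omega>. (Y \<omega>)\<^sup>2)"
definition C :: real where "C = expectation (\<lambda>\<omega>. X \<omega> * Y \<omega>)"

lemma measurable_X [measurable]: "random_variable borel X"
  and measurable_Y [measurable]: "random_variable borel Y"
proof -
  have "(\<lambda>\<omega>. (X \<omega>, Y \<omega>)) \<in> M \<rightarrow>\<^sub>M (borel \<Otimes>\<^sub>M borel)"
    using gaussian by (simp add: centered_gaussian_vector_def gaussian_vector_def borel_prod)
  then show "random_variable borel X" "random_variable borel Y"
    using measurable_compose[OF _ measurable_fst] measurable_compose[OF _ measurable_snd] by force+
qed

lemma linear_combination_law_ex:
  "\<exists>\<mu> \<sigma>. 0 \<le> \<sigma> \<and> distr M borel (\<lambda>\<omega>. p * X \<omega> + q * Y \<omega>) = gaussian_law \<mu> \<sigma>"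
proof -
  have "\<exists>\<mu> \<sigma>. 0 \<le> \<sigma> \<and> distr M borel (\<lambda>\<omega>. (X \<omega>, Y \<omega>) \<bullet> (p, q)) = gaussian_law \<mu> \<sigma>"
    using gaussian by (simp add: centered_gaussian_vector_def gaussian_vector_def)
  then show ?thesis by (simp add: inner_prod_def mult.commute)
qed

lemma integrable_linear_combination_power: "integrable M (\<lambda>\<omega>. (p * X \<omega> + q * Y \<omega>) ^ k)"
  using linear_combination_law_ex[of p q] gaussian_integrable_power[of "\<lambda>\<omega>. p * X \<omega> + q * Y \<omega>"]
  by auto

lemma integrable_X_power: "integrable M (\<lambda>\<omega>. X \<omega> ^ k)"
  using integrable_linear_combination_power[of 1 0] by simp

lemma integrable_Y_power: "integrable M (\<lambda>\<omega>. Y \<omega> ^ k)"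
  using integrable_linear_combination_power[of 0 1] by simp

lemma integrable_moment: "integrable M (\<lambda>\<omega>. X \<omega> ^ i * Y \<omega> ^ j)"
proof (rule Bochner_Integration.integrable_bound)
  show "integrable M (\<lambda>\<omega>. X \<omega> ^ (i * 2) + Y \<omega> ^ (j * 2))"
    by (intro Bochner_Integration.integrable_add integrable_X_power integrable_Y_power)
  have "\<bar>x * y\<bar> \<le> \<bar>x\<^sup>2 + y\<^sup>2\<bar>" for x y :: real
  proof -
    have "2 * (\<bar>x\<bar> * \<bar>y\<bar>) \<le> x\<^sup>2 + y\<^sup>2"
      using sum_squares_bound[of "\<bar>x\<bar>" "\<bar>y\<bar>"] by (simp add: mult.assoc)
    moreover have "0 \<le> \<bar>x\<bar> * \<bar>y\<bar>" by simp
    ultimately show ?thesis unfolding abs_mult by linarith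
  qed
  then show "AE \<omega> in M. norm (X \<omega> ^ i * Y \<omega> ^ j) \<le> norm (X \<omega> ^ (i * 2) + Y \<omega> ^ (j * 2))"
    by (simp add: power_mult)
qed simp

lemma linear_combination_law:
  obtains \<sigma> where "0 \<le> \<sigma>" "distr M borel (\<lambda>\<omega>. p * X \<omega> + q * Y \<omega>) = gaussian_law 0 \<sigma>"
proof -
  obtain \<mu> \<sigma> where law: "0 \<le> \<sigma>" "distr M borel (\<lambda>\<omega>. p * X \<omega> + q * Y \<omega>) = gaussian_law \<mu> \<sigma>"
    using linear_combination_law_ex by blast
  \<comment> \<open>The Bochner integral of a non-integrable function is 0 by default, so
    integrability of the vector comes before moving the inner product outside.\<close>
  have "integrable M (\<lambda>\<omega>. X \<omega> *\<^sub>R (1::real, 0::real) + Y \<omega> *\<^sub>R (0::real, 1::real))"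
    using integrable_X_power[of 1] integrable_Y_power[of 1]
    by (intro Bochner_Integration.integrable_add integrable_scaleR_left) simp_all
  then have "integrable M (\<lambda>\<omega>. (X \<omega>, Y \<omega>))" by simp
  then have "expectation (\<lambda>\<omega>. (X \<omega>, Y \<omega>) \<bullet> (p, q)) = expectation (\<lambda>\<omega>. (X \<omega>, Y \<omega>)) \<bullet> (p, q)"
    by (intro integral_inner_left) auto
  also have "\<dots> = 0" using gaussian by (simp add: centered_gaussian_vector_def)
  finally have "expectation (\<lambda>\<omega>. p * X \<omega> + q * Y \<omega>) = 0"
    by (simp add: inner_prod_def mult.commute)
  then have "\<mu> = 0"
    using gaussian_expectation[OF _ law(2,1)] by simp
  with law that show thesis by simp
qed

lemma expectation_X: "expectation X = 0" and expectation_Y: "expectation Y = 0"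
proof -
  obtain \<sigma> where "0 \<le> \<sigma>" "distr M borel (\<lambda>\<omega>. 1 * X \<omega> + 0 * Y \<omega>) = gaussian_law 0 \<sigma>"
    by (rule linear_combination_law)
  then show "expectation X = 0" using gaussian_expectation[of X 0 \<sigma>] by simp
  obtain \<sigma> where "0 \<le> \<sigma>" "distr M borel (\<lambda>\<omega>. 0 * X \<omega> + 1 * Y \<omega>) = gaussian_law 0 \<sigma>"
    by (rule linear_combination_law)
  then show "expectation Y = 0" using gaussian_expectation[of Y 0 \<sigma>] by simp
qed

lemma Var_X: "Var M X = V1" and Var_Y: "Var M Y = V2" and Cov_XY: "Cov M X Y = C"
  by (simp_all add: Var_def Cov_def V1_def V2_def C_def expectation_X expectation_Y)

lemma expectation_square:
  "expectation (\<lambda>\<omega>. (p * X \<omega> + q * Y \<omega>)\<^sup>2) = p\<^sup>2 * V1 + 2 * p * q * C + q\<^sup>2 * V2"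
proof -
  have "expectation (\<lambda>\<omega>. (p * X \<omega> + q * Y \<omega>)\<^sup>2) =
      expectation (\<lambda>\<omega>. p\<^sup>2 * (X \<omega>)\<^sup>2 + 2 * p * q * (X \<omega> * Y \<omega>) + q\<^sup>2 * (Y \<omega>)\<^sup>2)"
    by (intro Bochner_Integration.integral_cong) (auto simp: power2_eq_square algebra_simps)
  also have "\<dots> = p\<^sup>2 * V1 + 2 * p * q * C + q\<^sup>2 * V2"
    using integrable_X_power[of 2] integrable_Y_power[of 2] integrable_moment[of 1 1]
    by (simp add: V1_def V2_def C_def)
  finally show ?thesis .
qed

lemma linear_combination_char:
  "(\<integral>\<omega>. iexp (p * X \<omega> + q * Y \<omega>) \<partial>M) = exp (- (p\<^sup>2 * V1 + 2 * p * q * C + q\<^sup>2 * V2) / 2)"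
proof -
  obtain \<sigma> where "0 \<le> \<sigma>" "distr M borel (\<lambda>\<omega>. p * X \<omega> + q * Y \<omega>) = gaussian_law 0 \<sigma>"
    by (rule linear_combination_law)
  then show ?thesis
    using centered_gaussian_char[of "\<lambda>\<omega>. p * X \<omega> + q * Y \<omega>" \<sigma>] by (simp only: expectation_square) simp
qed

text \<open>The \<open>2 k\<close>-th moment of \<open>X + \<tau> Y\<close> is a constant times
  \<open>(V1 + 2 C \<tau> + V2 \<tau>^2)^k\<close>. Both sides are polynomials in \<tau>, so
  coefficients may be compared; no joint density is involved and a singular covariance is
  allowed.\<close>

lemma moment_coeff:
  assumes "j \<le> 2 * k"
  shows "real ((2 * k) choose j) * expectation (\<lambda>\<omega>. X \<omega> ^ (2 * k - j) * Y \<omega> ^ j) =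
    fact (2 * k) / (2 ^ k * fact k) * coeff ([:V1, 2 * C, V2:] ^ k) j"
proof -
  define e where "e j = real ((2 * k) choose j) * expectation (\<lambda>\<omega>. X \<omega> ^ (2 * k - j) * Y \<omega> ^ j)" for j
  define P where "P = (\<Sum>j\<le>2 * k. monom (e j) j)"
  define Q where "Q = smult (fact (2 * k) / (2 ^ k * fact k)) ([:V1, 2 * C, V2:] ^ k)"
  have "poly P \<tau> = poly Q \<tau>" for \<tau>
  proof -
    obtain \<sigma> where law: "0 \<le> \<sigma>" "distr M borel (\<lambda>\<omega>. 1 * X \<omega> + \<tau> * Y \<omega>) = gaussian_law 0 \<sigma>"
      by (rule linear_combination_law)
    have "poly P \<tau> = (\<Sum>j\<le>2 * k. expectation (\<lambda>\<omega>. real ((2 * k) choose j) * \<tau> ^ j * (X \<omega> ^ (2 * k - j) * Y \<omega> ^ j)))"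
      unfolding integral_mult_right_zero by (simp add: P_def poly_sum poly_monom e_def mult_ac)
    also have "\<dots> = expectation (\<lambda>\<omega>. \<Sum>j\<le>2 * k. real ((2 * k) choose j) * \<tau> ^ j * (X \<omega> ^ (2 * k - j) * Y \<omega> ^ j))"
      by (intro Bochner_Integration.integral_sum[symmetric] integrable_mult_right integrable_moment)
    also have "\<dots> = expectation (\<lambda>\<omega>. (1 * X \<omega> + \<tau> * Y \<omega>) ^ (2 * k))"
    proof (rule Bochner_Integration.integral_cong)
      fix \<omega>
      show "(\<Sum>j\<le>2 * k. real ((2 * k) choose j) * \<tau> ^ j * (X \<omega> ^ (2 * k - j) * Y \<omega> ^ j)) =
          (1 * X \<omega> + \<tau> * Y \<omega>) ^ (2 * k)"
        using binomial_ring[of "\<tau> * Y \<omega>" "X \<omega>" "2 * k"]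
        by (simp add: power_mult_distrib mult_ac add.commute)
    qed simp
    also have "\<dots> = fact (2 * k) / (2 ^ k * fact k) * (1\<^sup>2 * V1 + 2 * 1 * \<tau> * C + \<tau>\<^sup>2 * V2) ^ k"
      using centered_gaussian_moment_variance[OF _ law(2,1)] unfolding expectation_square by simp
    also have "\<dots> = poly Q \<tau>"
      by (simp add: Q_def power2_eq_square algebra_simps)
    finally show ?thesis .
  qed
  then have "P = Q" by (metis poly_eq_poly_eq_iff ext)
  then have "coeff P j = coeff Q j" by simp
  moreover have "coeff P j = e j" using assms by (simp add: P_def coeff_sum)
  ultimately show ?thesis by (simp add: e_def Q_def)
qed

context
  fixes m n :: nat
  assumes V_pos: "0 < V1" "0 < V2" and mn: "m \<le> n"
begin

text \<open>Factoring out the variances leaves the squared correlation as the only variable.\<close>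

lemma trinomial_sum_eq:
  "(\<Sum>i\<le>m. f i * V1 ^ (m - i) * V2 ^ (n - i) * C ^ (2 * i))
     = V1 ^ m * V2 ^ n * (\<Sum>i\<le>m. f i * (C\<^sup>2 / (V1 * V2)) ^ i)"
  unfolding sum_distrib_left
proof (rule sum.cong)
  fix i assume "i \<in> {..m}"
  then have "V1 ^ (m - i) = V1 ^ m / V1 ^ i" "V2 ^ (n - i) = V2 ^ n / V2 ^ i"
    using V_pos mn by (simp_all add: power_diff)
  then show "f i * V1 ^ (m - i) * V2 ^ (n - i) * C ^ (2 * i)
      = V1 ^ m * V2 ^ n * (f i * (C\<^sup>2 / (V1 * V2)) ^ i)"
    by (simp add: power_mult power_divide power_mult_distrib)
qed simp

lemma even_moment:
  "expectation (\<lambda>\<omega>. X \<omega> ^ (2 * m) * Y \<omega> ^ (2 * n)) =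
     fact (2 * m) * fact (2 * n) / (2 ^ (m + n) * fact m * fact n) * (V1 ^ m * V2 ^ n)
       * poly (even_poly m n) (C\<^sup>2 / (V1 * V2))" (is "?e = _")
proof -
  have idx: "2 * (m + n) - 2 * n = 2 * m" by simp
  have ch: "real ((2 * (m + n)) choose (2 * n)) = fact (2 * (m + n)) / (fact (2 * n) * fact (2 * m))"
    by (subst binomial_fact) (simp_all add: idx)
  have "fact (2 * (m + n)) / (fact (2 * n) * fact (2 * m)) * ?e =
      fact (2 * (m + n)) / (2 ^ (m + n) * fact (m + n)) * (fact (m + n) / (fact m * fact n) *
        (V1 ^ m * V2 ^ n * poly (even_poly m n) (C\<^sup>2 / (V1 * V2))))"
    using moment_coeff[of "2 * n" "m + n"]
    unfolding idx ch coeff_trinomial_power_even[OF mn] trinomial_sum_eq moment_pair.poly_A by simp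
  then show ?thesis by (simp add: field_simps)
qed

lemma odd_moment:
  "expectation (\<lambda>\<omega>. X \<omega> ^ (2 * m + 1) * Y \<omega> ^ (2 * n + 1)) =
     fact (2 * m + 1) * fact (2 * n + 1) / (2 ^ (m + n) * fact m * fact n) * (V1 ^ m * V2 ^ n)
       * C * poly (odd_poly m n) (C\<^sup>2 / (V1 * V2))" (is "?e = _")
proof -
  have idx: "2 * (m + n + 1) - (2 * n + 1) = 2 * m + 1" by simp
  have ch: "real ((2 * (m + n + 1)) choose (2 * n + 1))
      = fact (2 * (m + n + 1)) / (fact (2 * n + 1) * fact (2 * m + 1))"
    by (subst binomial_fact) (simp_all only: idx, simp)
  have "fact (2 * (m + n + 1)) / (fact (2 * n + 1) * fact (2 * m + 1)) * ?e =
      fact (2 * (m + n + 1)) / (2 ^ (m + n + 1) * fact (m + n + 1)) * (fact (m + n + 1) / (fact m * fact n) *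
        (2 * C * (V1 ^ m * V2 ^ n * poly (odd_poly m n) (C\<^sup>2 / (V1 * V2)))))"
    using moment_coeff[of "2 * n + 1" "m + n + 1"]
    unfolding idx ch coeff_trinomial_power_odd[OF mn] trinomial_sum_eq moment_pair.poly_B by simp
  \<comment> \<open>The cancellation is stated for arbitrary reals, so that simplification does not
    unfold the factorials.\<close>
  moreover have "e = b * a / (2 ^ (m + n) * c * d) * v * C * x"
    if "F / (a * b) * e = F / (2 ^ (m + n + 1) * G) * (G / (c * d) * (2 * C * (v * x)))"
      "F \<noteq> 0" "G \<noteq> 0" "a \<noteq> 0" "b \<noteq> 0" "c \<noteq> 0" "d \<noteq> 0" for F G a b c d e v x :: real
    using that by (simp add: field_simps)
  ultimately show ?thesis using fact_nonzero by blast
qed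

end

text \<open>If \<open>C = 0\<close>, the exponent of the joint characteristic function has no cross
  term, so the function factorises.\<close>

lemma indep_var_iff: "indep_var borel X borel Y \<longleftrightarrow> C = 0"
proof
  assume "indep_var borel X borel Y"
  then show "C = 0"
    using indep_var_lebesgue_integral[of X Y] integrable_X_power[of 1] integrable_Y_power[of 1]
    by (simp add: C_def expectation_X)
next
  assume "C = 0"
  then have "(\<integral>\<omega>. iexp (p * X \<omega> + q * Y \<omega>) \<partial>M) =
      (\<integral>\<omega>. iexp (p * X \<omega>) \<partial>M) * (\<integral>\<omega>. iexp (q * Y \<omega>) \<partial>M)" for p q
    using linear_combination_char[of p q] linear_combination_char[of p 0] linear_combination_char[of 0 q]
    by (simp add: exp_add[symmetric] add_divide_distrib diff_divide_distrib flip: exp_of_real)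
  then show "indep_var borel X borel Y"
    by (intro indep_var_of_char) auto
qed

text \<open>Cauchy-Schwarz, from the nonnegative second moment of \<open>C X - V1 Y\<close>.\<close>

lemma C_square_le: "0 < V1 \<Longrightarrow> C\<^sup>2 \<le> V1 * V2"
proof -
  assume "0 < V1"
  have "0 \<le> expectation (\<lambda>\<omega>. (C * X \<omega> + (- V1) * Y \<omega>)\<^sup>2)" by simp
  also have "\<dots> = V1 * (V1 * V2 - C\<^sup>2)" unfolding expectation_square by algebra
  finally show ?thesis using \<open>0 < V1\<close> by (simp add: zero_le_mult_iff)
qed

text \<open>The two moments share the constant \<open>K\<close>; the explicit factor
  \<open>(2 m + 1) (2 n + 1)\<close> is exactly the surplus of the odd factorials.\<close>

lemma moment_ratio:
  assumes "0 < V1" "0 < V2" "m \<le> n"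
  defines "x \<equiv> C\<^sup>2 / (V1 * V2)"
  shows "\<bar>expectation (\<lambda>\<omega>. X \<omega> ^ (2 * m + 1) * Y \<omega> ^ (2 * n + 1))\<bar> /
      ((2 * real m + 1) * (2 * real n + 1) * expectation (\<lambda>\<omega>. X \<omega> ^ (2 * m) * Y \<omega> ^ (2 * n)))
    = poly (odd_poly m n) x / poly (even_poly m n) x * \<bar>C\<bar>"
proof -
  define K where "K = fact (2 * m) * fact (2 * n) / (2 ^ (m + n) * fact m * fact n) * (V1 ^ m * V2 ^ n)"
  have K: "K > 0" using assms by (simp add: K_def)
  have x: "x \<ge> 0" using assms by (simp add: x_def)
  have f: "fact (2 * k + 1) = (2 * real k + 1) * fact (2 * k)" for k by simp
  have ab: "(2 * real m + 1) * (2 * real n + 1) > 0" by (intro mult_pos_pos add_nonneg_pos) auto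
  have odd: "expectation (\<lambda>\<omega>. X \<omega> ^ (2 * m + 1) * Y \<omega> ^ (2 * n + 1))
      = (2 * real m + 1) * (2 * real n + 1) * K * poly (odd_poly m n) x * C"
    unfolding odd_moment[OF assms(1-3)] x_def[symmetric] f K_def by (simp only: times_divide_eq_left times_divide_eq_right mult_ac)
  have even: "expectation (\<lambda>\<omega>. X \<omega> ^ (2 * m) * Y \<omega> ^ (2 * n)) = K * poly (even_poly m n) x"
    unfolding even_moment[OF assms(1-3)] x_def[symmetric] K_def ..
  have "\<bar>d * K * p * c\<bar> / (d * (K * e)) = p / e * \<bar>c\<bar>" if "d > 0" "p > 0" "e > 0" for c d e p
    using that K by (simp add: abs_mult)
  then show ?thesis
    unfolding odd even using ab moment_pair.poly_A_pos[OF x, of m n] moment_pair.poly_B_pos[OF x, of m n]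
    by blast
qed

end

section \<open>The inequality and its equality case\<close>

theorem theorem1p2:
  fixes M :: "'w measure" and X2 X3 :: "'w \<Rightarrow> real" and m2 m3 :: nat
  assumes "prob_space M"
    and "centered_gaussian_vector M (\<lambda>\<omega>. (X2 \<omega>, X3 \<omega>))"
    and "Var M X2 > 0" and "Var M X3 > 0"
    and "(m2, m3) \<in> S_set"
  shows "let lhs = \<bar>\<integral>\<omega>. X2 \<omega> ^ (2 * m2 + 1) * X3 \<omega> ^ (2 * m3 + 1) \<partial>M\<bar> /
               ((2 * real m2 + 1) * (2 * real m3 + 1) *
                (\<integral>\<omega>. X2 \<omega> ^ (2 * m2) * X3 \<omega> ^ (2 * m3) \<partial>M));
             rhs = (if \<bar>Corr M X2 X3\<bar> \<le> sqrt (t_const m2 m3)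
                    then \<bar>Cov M X2 X3\<bar>
                    else H_fun m2 m3 ((Corr M X2 X3)\<^sup>2) * \<bar>Cov M X2 X3\<bar>)
         in lhs \<le> rhs \<and> (lhs = rhs \<longleftrightarrow> prob_space.indep_var M borel X2 borel X3)"
proof -
  interpret prob_space M by fact
  interpret centered_gaussian_pair M X2 X3 by unfold_locales fact
  interpret moment_pair m2 m3 .
  have V: "0 < V1" "0 < V2" using assms(3,4) by (simp_all add: Var_X Var_Y)
  have mn: "1 \<le> m2" "m2 \<le> m3" "1 \<le> m3" using S_setD[OF assms(5)] by auto
  define x where "x = C\<^sup>2 / (V1 * V2)"
  have x: "(Corr M X2 X3)\<^sup>2 = x"
    using V by (simp add: Corr_def Var_X Var_Y Cov_XY x_def power_divide)
  have "x \<le> 1" using C_square_le V by (simp add: x_def divide_le_eq)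
  have corr: "\<bar>Corr M X2 X3\<bar> \<le> sqrt (t_const m2 m3) \<longleftrightarrow> x \<le> t_const m2 m3"
    unfolding x[symmetric] by (simp flip: real_sqrt_abs)
  \<comment> \<open>The factor of \<open>\<bar>C\<bar>\<close> in whichever branch applies; it is
    compared with \<open>B / A\<close> by \<open>poly_B_less_A\<close> or
    \<open>ratio_less_H_fun\<close>.\<close>
  define h where "h = (if x \<le> t_const m2 m3 then 1 else H_fun m2 m3 x)"
  have less: "poly B x / poly A x < h" if "C \<noteq> 0"
  proof -
    have "x > 0" using that V by (simp add: x_def)
    then show ?thesis
      using poly_B_less_A[OF mn(1,3)] poly_A_pos[of x] ratio_less_H_fun[OF assms(5)] \<open>x \<le> 1\<close>
      by (auto simp: h_def)
  qed
  have lhs: "\<bar>\<integral>\<omega>. X2 \<omega> ^ (2 * m2 + 1) * X3 \<omega> ^ (2 * m3 + 1) \<partial>M\<bar> /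
      ((2 * real m2 + 1) * (2 * real m3 + 1) * (\<integral>\<omega>. X2 \<omega> ^ (2 * m2) * X3 \<omega> ^ (2 * m3) \<partial>M))
    = poly B x / poly A x * \<bar>C\<bar>"
    unfolding x_def by (rule moment_ratio[OF V mn(2)])
  have rhs: "(if \<bar>Corr M X2 X3\<bar> \<le> sqrt (t_const m2 m3) then \<bar>Cov M X2 X3\<bar>
      else H_fun m2 m3 ((Corr M X2 X3)\<^sup>2) * \<bar>Cov M X2 X3\<bar>) = h * \<bar>C\<bar>"
    unfolding corr x Cov_XY h_def by simp
  \<comment> \<open>The bound is strict for \<open>C \<noteq> 0\<close> and both sides vanish for
    \<open>C = 0\<close>, so equality means \<open>C = 0\<close>, that is independence.\<close>
  have "poly B x / poly A x * \<bar>C\<bar> < h * \<bar>C\<bar>" if "C \<noteq> 0"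
    using less[OF that] that by (intro mult_strict_right_mono) auto
  then show ?thesis
    unfolding Let_def lhs rhs indep_var_iff by (cases "C = 0") (simp, force)
qed

end
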